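(* There exists no Lorentzian minimal surface in the Minkowski space $\mathbb{E}^4_1$ with null 2-type Gauss map.
   Context: $\mathbb{E}^4_1$ is Minkowski space-time: $\mathbb{R}^4$ with the metric $\langle\cdot,\cdot\rangle$ of signature $(-,+,+,+)$. All surfaces are smooth and connected. A surface $M\subset\mathbb{E}^4_1$ is Lorentzian if its induced metric is non-degenerate of index 1. Let $\nabla$ be the Levi-Civita connection of $M$ and $h$ its second fundamental form. Let $\{f_1,f_2\}$ be a local pseudo-orthonormal frame of the tangent bundle: $\langle f_1,f_1\rangle=\langle f_2,f_2\rangle=0$, $\langle f_1,f_2\rangle=-1$, compatible with a fixed orientation of $M$. The mean curvature vector is $H=-h(f_1,f_2)$, and $M$ is minimal if $H=0$. The Laplace operator of $M$ is $\Delta=f_1f_2+f_2f_1-\nabla_{f_1}f_2-\nabla_{f_2}f_1$, applied componentwise to vector-valued maps. The Gauss map of $M$ is $\nu=f_1\wedge f_2:M\to\Lambda^2\mathbb{E}^4_1\cong\mathbb{E}^6_3$. The Gauss map $\nu$ is $k$-type if $\nu=\nu_0+\nu_1+\cdots+\nu_k$, where $\nu_0$ is a constant vector and each $\nu_i$ ($1\le i\le k$) is a non-constant eigenvector of $\Delta$ (a smooth $\mathbb{E}^6_3$-valued map with $\Delta\nu_i=\lambda_i\nu_i$), with real eigenvalues $\lambda_1<\lambda_2<\cdots<\lambda_k$. It is null $k$-type if in addition one of the $\lambda_i$ is zero. *)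

theory Defs
  imports "HOL-Analysis.Analysis"
begin

section \<open>Smooth maps between Euclidean spaces\<close>

text \<open>Meant for open \<open>U\<close> and a finite-dimensional domain, where it is the usual class \<open>C\<^sup>k\<close>.\<close>

primrec Ck_on :: "nat \<Rightarrow> 'a::euclidean_space set \<Rightarrow> ('a \<Rightarrow> 'b::real_normed_vector) \<Rightarrow> bool" where
  "Ck_on 0 U f \<longleftrightarrow> continuous_on U f"
| "Ck_on (Suc k) U f \<longleftrightarrow>
     (\<forall>p\<in>U. f differentiable (at p)) \<and>
     (\<forall>v. Ck_on k U (\<lambda>p. frechet_derivative f (at p) v))"

definition smooth_on :: "'a::euclidean_space set \<Rightarrow> ('a \<Rightarrow> 'b::real_normed_vector) \<Rightarrow> bool" where
  "smooth_on U f \<longleftrightarrow> (\<forall>k. Ck_on k U f)"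

section \<open>Minkowski space-time and bivectors\<close>

definition mink :: "real^4 \<Rightarrow> real^4 \<Rightarrow> real" where
  "mink a b = - (a$1 * b$1) + a$2 * b$2 + a$3 * b$3 + a$4 * b$4"

text \<open>The components refer to the basis \<open>e\<^sub>1\<and>e\<^sub>2, e\<^sub>1\<and>e\<^sub>3, e\<^sub>1\<and>e\<^sub>4, e\<^sub>2\<and>e\<^sub>3, e\<^sub>2\<and>e\<^sub>4, e\<^sub>3\<and>e\<^sub>4\<close>, which is
  pseudo-orthonormal for the metric that \<^const>\<open>mink\<close> induces on bivectors; its first three members
  are timelike, so that the space of bivectors is \<open>E\<^sup>6\<^sub>3\<close>.\<close>

definition wedge :: "real^4 \<Rightarrow> real^4 \<Rightarrow> real^6" where
  "wedge a b = vector [a$1 * b$2 - a$2 * b$1, a$1 * b$3 - a$3 * b$1, a$1 * b$4 - a$4 * b$1,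
                       a$2 * b$3 - a$3 * b$2, a$2 * b$4 - a$4 * b$2, a$3 * b$4 - a$4 * b$3]"

text \<open>The index of a bilinear form is the largest dimension of a negative definite subspace.\<close>

definition form_index :: "('v::euclidean_space \<Rightarrow> 'v \<Rightarrow> real) \<Rightarrow> nat" where
  "form_index B = Max {dim W | W. subspace W \<and> (\<forall>w\<in>W. w \<noteq> 0 \<longrightarrow> B w w < 0)}"

definition nondegenerate :: "('v::euclidean_space \<Rightarrow> 'v \<Rightarrow> real) \<Rightarrow> bool" where
  "nondegenerate B \<longleftrightarrow> (\<forall>v. (\<forall>w. B v w = 0) \<longrightarrow> v = 0)"

section \<open>Geometry of a parametrized piece of a surface\<close>

text \<open>Here \<open>X\<close> is a parametrization, defined on an open set of the parameter plane. Tangent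
  vectors, vector fields and functions on the surface are expressed in the parameters.\<close>

definition vf_deriv :: "(real^2 \<Rightarrow> real^2) \<Rightarrow> (real^2 \<Rightarrow> 'b::real_normed_vector) \<Rightarrow> real^2 \<Rightarrow> 'b" where
  "vf_deriv Y f p = frechet_derivative f (at p) (Y p)"

definition first_form :: "(real^2 \<Rightarrow> real^4) \<Rightarrow> real^2 \<Rightarrow> real^2 \<Rightarrow> real^2 \<Rightarrow> real" where
  "first_form X p v w = mink (frechet_derivative X (at p) v) (frechet_derivative X (at p) w)"

definition metric_matrix :: "(real^2 \<Rightarrow> real^4) \<Rightarrow> real^2 \<Rightarrow> real^2^2" where
  "metric_matrix X p = (\<chi> i j. first_form X p (axis i 1) (axis j 1))"

text \<open>\<open>metric_partial X p l i j\<close> is the partial derivative in direction \<open>l\<close> of the metric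
  coefficient with indices \<open>i, j\<close>.\<close>

definition metric_partial :: "(real^2 \<Rightarrow> real^4) \<Rightarrow> real^2 \<Rightarrow> 2 \<Rightarrow> 2 \<Rightarrow> 2 \<Rightarrow> real" where
  "metric_partial X p l i j =
     frechet_derivative (\<lambda>q. metric_matrix X q $ i $ j) (at p) (axis l 1)"

text \<open>\<open>christoffel X p k i j\<close> has upper index \<open>k\<close> and lower indices \<open>i, j\<close>.\<close>

definition christoffel :: "(real^2 \<Rightarrow> real^4) \<Rightarrow> real^2 \<Rightarrow> 2 \<Rightarrow> 2 \<Rightarrow> 2 \<Rightarrow> real" where
  "christoffel X p k i j =
     (1/2) * (\<Sum>l\<in>UNIV. matrix_inv (metric_matrix X p) $ k $ l *
        (metric_partial X p i j l + metric_partial X p j i l - metric_partial X p l i j))"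

definition levi_civita ::
  "(real^2 \<Rightarrow> real^4) \<Rightarrow> (real^2 \<Rightarrow> real^2) \<Rightarrow> (real^2 \<Rightarrow> real^2) \<Rightarrow> real^2 \<Rightarrow> real^2" where
  "levi_civita X Y Z p = vf_deriv Y Z p +
     (\<chi> k. \<Sum>i\<in>UNIV. \<Sum>j\<in>UNIV. christoffel X p k i j * (Y p $ i) * (Z p $ j))"

text \<open>The second fundamental form, by the Gauss formula: the derivative in the ambient flat space of
  the tangent field \<open>Z\<close> along \<open>Y\<close>, minus its intrinsic covariant derivative.\<close>

definition second_form ::
  "(real^2 \<Rightarrow> real^4) \<Rightarrow> (real^2 \<Rightarrow> real^2) \<Rightarrow> (real^2 \<Rightarrow> real^2) \<Rightarrow> real^2 \<Rightarrow> real^4" where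
  "second_form X Y Z p =
     vf_deriv Y (\<lambda>q. frechet_derivative X (at q) (Z q)) p
     - frechet_derivative X (at p) (levi_civita X Y Z p)"

definition pseudo_orthonormal_frame ::
  "(real^2 \<Rightarrow> real^4) \<Rightarrow> (real^2) set \<Rightarrow> (real^2 \<Rightarrow> real^2) \<Rightarrow> (real^2 \<Rightarrow> real^2) \<Rightarrow> bool" where
  "pseudo_orthonormal_frame X W f\<^sub>1 f\<^sub>2 \<longleftrightarrow>
     open W \<and> smooth_on W f\<^sub>1 \<and> smooth_on W f\<^sub>2 \<and>
     (\<forall>p\<in>W. first_form X p (f\<^sub>1 p) (f\<^sub>1 p) = 0 \<and> first_form X p (f\<^sub>2 p) (f\<^sub>2 p) = 0 \<and>
            first_form X p (f\<^sub>1 p) (f\<^sub>2 p) = -1)"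

definition positively_oriented :: "(real^2) set \<Rightarrow> (real^2 \<Rightarrow> real^2) \<Rightarrow> (real^2 \<Rightarrow> real^2) \<Rightarrow> bool" where
  "positively_oriented W f\<^sub>1 f\<^sub>2 \<longleftrightarrow> (\<forall>p\<in>W. f\<^sub>1 p $ 1 * f\<^sub>2 p $ 2 - f\<^sub>1 p $ 2 * f\<^sub>2 p $ 1 > 0)"

definition mean_curvature ::
  "(real^2 \<Rightarrow> real^4) \<Rightarrow> (real^2 \<Rightarrow> real^2) \<Rightarrow> (real^2 \<Rightarrow> real^2) \<Rightarrow> real^2 \<Rightarrow> real^4" where
  "mean_curvature X f\<^sub>1 f\<^sub>2 p = - second_form X f\<^sub>1 f\<^sub>2 p"

definition laplacian ::
  "(real^2 \<Rightarrow> real^4) \<Rightarrow> (real^2 \<Rightarrow> real^2) \<Rightarrow> (real^2 \<Rightarrow> real^2) \<Rightarrow>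
   (real^2 \<Rightarrow> 'b::real_normed_vector) \<Rightarrow> real^2 \<Rightarrow> 'b" where
  "laplacian X f\<^sub>1 f\<^sub>2 \<phi> p =
     vf_deriv f\<^sub>1 (vf_deriv f\<^sub>2 \<phi>) p + vf_deriv f\<^sub>2 (vf_deriv f\<^sub>1 \<phi>) p
     - vf_deriv (levi_civita X f\<^sub>1 f\<^sub>2) \<phi> p - vf_deriv (levi_civita X f\<^sub>2 f\<^sub>1) \<phi> p"

section \<open>Surfaces\<close>

text \<open>A surface is an abstract 2-manifold with an immersion into space-time. A member \<open>(U, x)\<close> of
  \<open>params\<close> is a local parametrization: \<open>x\<close> maps the open set \<open>U\<close> of the plane homeomorphically onto
  an open set of the manifold.\<close>

record 'a surface =
  carrier_top :: "'a topology"
  params :: "((real^2) set \<times> (real^2 \<Rightarrow> 'a)) set"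
  immersion :: "'a \<Rightarrow> real^4"

text \<open>The orientation is the one given by the parametrizations, whose changes of parameters have
  positive Jacobian determinant.\<close>

definition oriented_surface :: "'a surface \<Rightarrow> bool" where
  "oriented_surface S \<longleftrightarrow>
     Hausdorff_space (carrier_top S) \<and> second_countable (carrier_top S) \<and>
     connected_space (carrier_top S) \<and>
     (\<forall>(U, x)\<in>params S. open U \<and> openin (carrier_top S) (x ` U) \<and>
        homeomorphic_map (top_of_set U) (subtopology (carrier_top S) (x ` U)) x) \<and>
     topspace (carrier_top S) = (\<Union>(U, x)\<in>params S. x ` U) \<and>
     (\<forall>(U, x)\<in>params S. \<forall>(V, y)\<in>params S.
        let W = {u\<in>U. x u \<in> y ` V}; t = inv_into V y \<circ> x
        in smooth_on W t \<and> (\<forall>u\<in>W. det (jacobian t (at u)) > 0)) \<and>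
     (\<forall>(U, x)\<in>params S. smooth_on U (immersion S \<circ> x) \<and>
        (\<forall>u\<in>U. inj (frechet_derivative (immersion S \<circ> x) (at u))))"

definition lorentzian_surface :: "'a surface \<Rightarrow> bool" where
  "lorentzian_surface S \<longleftrightarrow> oriented_surface S \<and>
     (\<forall>(U, x)\<in>params S. \<forall>u\<in>U.
        nondegenerate (first_form (immersion S \<circ> x) u) \<and>
        form_index (first_form (immersion S \<circ> x) u) = 1)"

text \<open>\<open>local_frame S x W f\<^sub>1 f\<^sub>2\<close>: the fields \<open>f\<^sub>1, f\<^sub>2\<close> on \<open>W\<close> are the expression, in a
  parametrization \<open>x\<close>, of a local pseudo-orthonormal frame compatible with the orientation.\<close>

definition local_frame ::
  "'a surface \<Rightarrow> (real^2 \<Rightarrow> 'a) \<Rightarrow> (real^2) set \<Rightarrow> (real^2 \<Rightarrow> real^2) \<Rightarrow> (real^2 \<Rightarrow> real^2) \<Rightarrow> bool" where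
  "local_frame S x W f\<^sub>1 f\<^sub>2 \<longleftrightarrow>
     (\<exists>U. (U, x) \<in> params S \<and> W \<subseteq> U) \<and>
     pseudo_orthonormal_frame (immersion S \<circ> x) W f\<^sub>1 f\<^sub>2 \<and> positively_oriented W f\<^sub>1 f\<^sub>2"

text \<open>The mean curvature vector, the Gauss map and the Laplace operator do not depend on the frame,
  and on a Lorentzian surface every point has a local frame. The following notions therefore refer
  to all local frames.\<close>

definition minimal_surface :: "'a surface \<Rightarrow> bool" where
  "minimal_surface S \<longleftrightarrow>
     (\<forall>x W f\<^sub>1 f\<^sub>2. local_frame S x W f\<^sub>1 f\<^sub>2 \<longrightarrow>
        (\<forall>p\<in>W. mean_curvature (immersion S \<circ> x) f\<^sub>1 f\<^sub>2 p = 0))"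

definition is_gauss_map :: "'a surface \<Rightarrow> ('a \<Rightarrow> real^6) \<Rightarrow> bool" where
  "is_gauss_map S \<nu> \<longleftrightarrow>
     (\<forall>x W f\<^sub>1 f\<^sub>2. local_frame S x W f\<^sub>1 f\<^sub>2 \<longrightarrow>
        (\<forall>p\<in>W. \<nu> (x p) = wedge (frechet_derivative (immersion S \<circ> x) (at p) (f\<^sub>1 p))
                                (frechet_derivative (immersion S \<circ> x) (at p) (f\<^sub>2 p))))"

definition smooth_map :: "'a surface \<Rightarrow> ('a \<Rightarrow> 'b::real_normed_vector) \<Rightarrow> bool" where
  "smooth_map S \<phi> \<longleftrightarrow> (\<forall>(U, x)\<in>params S. smooth_on U (\<phi> \<circ> x))"

definition laplace_eigenvector :: "'a surface \<Rightarrow> real \<Rightarrow> ('a \<Rightarrow> 'b::real_normed_vector) \<Rightarrow> bool" where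
  "laplace_eigenvector S \<mu> \<phi> \<longleftrightarrow> smooth_map S \<phi> \<and>
     (\<forall>x W f\<^sub>1 f\<^sub>2. local_frame S x W f\<^sub>1 f\<^sub>2 \<longrightarrow>
        (\<forall>p\<in>W. laplacian (immersion S \<circ> x) f\<^sub>1 f\<^sub>2 (\<phi> \<circ> x) p = \<mu> *\<^sub>R \<phi> (x p)))"

section \<open>Maps of finite type\<close>

definition k_type_decomposition ::
  "'a surface \<Rightarrow> nat \<Rightarrow> ('a \<Rightarrow> real^6) \<Rightarrow> real^6 \<Rightarrow> (nat \<Rightarrow> 'a \<Rightarrow> real^6) \<Rightarrow> (nat \<Rightarrow> real) \<Rightarrow> bool" where
  "k_type_decomposition S k \<nu> c \<nu>s \<mu>s \<longleftrightarrow>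
     (\<forall>p\<in>topspace (carrier_top S). \<nu> p = c + (\<Sum>i=1..k. \<nu>s i p)) \<and>
     (\<forall>i\<in>{1..k}. laplace_eigenvector S (\<mu>s i) (\<nu>s i) \<and>
                 \<not> \<nu>s i constant_on topspace (carrier_top S)) \<and>
     strict_mono_on {1..k} \<mu>s"

definition k_type :: "'a surface \<Rightarrow> nat \<Rightarrow> ('a \<Rightarrow> real^6) \<Rightarrow> bool" where
  "k_type S k \<nu> \<longleftrightarrow> (\<exists>c \<nu>s \<mu>s. k_type_decomposition S k \<nu> c \<nu>s \<mu>s)"

definition null_k_type :: "'a surface \<Rightarrow> nat \<Rightarrow> ('a \<Rightarrow> real^6) \<Rightarrow> bool" where
  "null_k_type S k \<nu> \<longleftrightarrow>
     (\<exists>c \<nu>s \<mu>s. k_type_decomposition S k \<nu> c \<nu>s \<mu>s \<and> (\<exists>i\<in>{1..k}. \<mu>s i = 0))"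

end

theory Submission
  imports Defs
begin

text \<open>
  Near a point of a Lorentzian minimal surface choose a pseudo-orthonormal frame \<open>f\<^sub>1, f\<^sub>2\<close> and let
  \<open>e\<^sub>1, e\<^sub>2\<close> be its image in space-time. Minimality says that \<open>e\<^sub>2\<close> only changes by a multiple of itself
  along \<open>f\<^sub>1\<close>, and \<open>e\<^sub>1\<close> by a multiple of itself along \<open>f\<^sub>2\<close>. Hence \<open>f\<^sub>1 \<nu> = h \<and> e\<^sub>2\<close> and
  \<open>f\<^sub>2 \<nu> = e\<^sub>1 \<and> k\<close> for normal fields \<open>h, k\<close>, and \<open>\<Delta> \<nu>\<close> is a combination of \<open>\<nu>\<close> and
  \<open>h \<and> k\<close>.

  The decisive step is to identify bivectors with complex 3-vectors (\<open>complex_part\<close>; the imaginary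
  unit acts as a Hodge star). The normal bivector \<open>h \<and> k\<close> is then a complex multiple of the tangent
  bivector \<open>\<nu>\<close>, since the planes are orthogonal. So the Gauss map becomes a map \<open>N\<close> to the complex
  quadric \<open>N \<cdot> N = 1\<close>, with null derivatives along \<open>f\<^sub>1\<close> and \<open>f\<^sub>2\<close>, and \<open>\<Delta> N = \<phi> N\<close> for a complex
  function \<open>\<phi>\<close>.

  If \<open>\<nu> = c + A + B\<close> with \<open>\<Delta> A = \<mu> A\<close>, \<open>\<Delta> B = 0\<close> and \<open>\<mu> \<noteq> 0\<close>, then \<open>\<phi> N\<close> is the complex form of
  \<open>\<mu> A\<close>, so \<open>\<Delta> (\<phi> N) = \<mu> \<phi> N\<close>. Expanding the left-hand side with the product rule, the component
  orthogonal to \<open>N\<close> forces \<open>\<phi>\<close> to have zero derivative wherever it does not vanish, and then the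
  component along \<open>N\<close> gives \<open>\<phi> = \<mu>\<close> there (\<open>null_gauss_map_dichotomy\<close>). So at every point \<open>\<phi> = 0\<close>
  or \<open>\<phi> = \<mu>\<close>, that is, \<open>A = 0\<close> or \<open>A = \<nu>\<close> (\<open>eigenvector_dichotomy\<close>); not both, as \<open>\<nu> \<noteq> 0\<close>.
  Since \<open>A = \<nu>\<close> means \<open>B = - c\<close>, both conditions are closed, and by connectedness one of them holds on
  the whole surface. Then \<open>A\<close> or \<open>B\<close> is constant, contrary to the definition of finite type.
\<close>

section \<open>Calculus of smooth maps\<close>

lemma Ck_on_Suc_imp_Ck_on: "Ck_on (Suc k) U f \<Longrightarrow> Ck_on k U f"
proof (induction k arbitrary: f)
  case 0
  then show ?case
    by (auto intro!: continuous_at_imp_continuous_on differentiable_imp_continuous_within)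
next
  case (Suc k)
  then show ?case by simp
qed

lemma Ck_on_cong:
  assumes "open U" "Ck_on k U f" "\<And>p. p \<in> U \<Longrightarrow> f p = g p"
  shows "Ck_on k U g"
  using assms(2,3)
proof (induction k arbitrary: f g)
  case 0
  then show ?case by (auto cong: continuous_on_cong)
next
  case (Suc k)
  have d: "g differentiable at p" if "p \<in> U" for p
    using Suc.prems that \<open>open U\<close>
    by (metis Ck_on.simps(2) differentiable_def has_derivative_transform_within_open)
  have "frechet_derivative f (at p) = frechet_derivative g (at p)" if "p \<in> U" for p
    using Suc.prems that \<open>open U\<close>
    by (metis Ck_on.simps(2) frechet_derivative_transform_within_open)
  then have "Ck_on k U (\<lambda>p. frechet_derivative g (at p) v)" for v
    using Suc.prems(1) Suc.IH[of "\<lambda>p. frechet_derivative f (at p) v"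
        "\<lambda>p. frechet_derivative g (at p) v"] by simp
  then show ?case using d by simp
qed

text \<open>The way to show that the explicit formulas below belong to \<open>C\<^sup>k\<^sup>+\<^sup>1\<close>: exhibit a derivative and show
  that it is of class \<open>C\<^sup>k\<close>.\<close>

lemma Ck_on_SucI:
  assumes "open U" "\<And>p. p \<in> U \<Longrightarrow> (f has_derivative D p) (at p)" "\<And>v. Ck_on k U (\<lambda>p. D p v)"
  shows "Ck_on (Suc k) U f"
proof -
  have "Ck_on k U (\<lambda>p. frechet_derivative f (at p) v)" for v
    using assms(3)[of v] by (rule Ck_on_cong[OF \<open>open U\<close>]) (simp add: frechet_derivative_at[OF assms(2), symmetric])
  then show ?thesis using assms(2) by (auto simp: differentiable_def)
qed

lemma Ck_on_subset: "Ck_on k U f \<Longrightarrow> W \<subseteq> U \<Longrightarrow> Ck_on k W f"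
  by (induction k arbitrary: f) (auto intro: continuous_on_subset)

lemma Ck_on_const: "Ck_on k U (\<lambda>p. c)"
  by (induction k arbitrary: c) auto

lemma Ck_on_add:
  assumes "open U" "Ck_on k U f" "Ck_on k U g"
  shows "Ck_on k U (\<lambda>p. f p + g p)"
  using assms(2,3)
proof (induction k arbitrary: f g)
  case 0
  then show ?case by (auto intro: continuous_on_add)
next
  case (Suc k)
  show ?case
  proof (rule Ck_on_SucI[OF \<open>open U\<close>])
    show "((\<lambda>q. f q + g q) has_derivative
        (\<lambda>v. frechet_derivative f (at p) v + frechet_derivative g (at p) v)) (at p)"
      if "p \<in> U" for p
      using Suc.prems that
      by (intro has_derivative_add) (auto simp: frechet_derivative_works[symmetric])
    show "Ck_on k U (\<lambda>p. frechet_derivative f (at p) v + frechet_derivative g (at p) v)" for v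
      using Suc.prems by (intro Suc.IH) auto
  qed
qed

lemma Ck_on_bilinear:
  assumes B: "bounded_bilinear B" and "open U" "Ck_on k U f" "Ck_on k U g"
  shows "Ck_on k U (\<lambda>p. B (f p) (g p))"
  using assms(3,4)
proof (induction k arbitrary: f g)
  case 0
  then show ?case by (auto intro: bounded_bilinear.continuous_on[OF B])
next
  case (Suc k)
  show ?case
  proof (rule Ck_on_SucI[OF \<open>open U\<close>])
    show "((\<lambda>q. B (f q) (g q)) has_derivative
        (\<lambda>v. B (f p) (frechet_derivative g (at p) v) + B (frechet_derivative f (at p) v) (g p))) (at p)"
      if "p \<in> U" for p
      using Suc.prems that
      by (intro bounded_bilinear.FDERIV[OF B]) (auto simp: frechet_derivative_works[symmetric])
    show "Ck_on k U (\<lambda>p. B (f p) (frechet_derivative g (at p) v) + B (frechet_derivative f (at p) v) (g p))"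
      for v
      using Suc.prems Ck_on_Suc_imp_Ck_on[OF Suc.prems(1)] Ck_on_Suc_imp_Ck_on[OF Suc.prems(2)]
      by (intro Ck_on_add \<open>open U\<close> Suc.IH) auto
  qed
qed

lemma Ck_on_linear:
  assumes L: "bounded_linear L" and "open U" "Ck_on k U f"
  shows "Ck_on k U (\<lambda>p. L (f p))"
  using assms(3)
proof (induction k arbitrary: f)
  case 0
  then show ?case using bounded_linear.continuous_on[OF L] by simp
next
  case (Suc k)
  show ?case
  proof (rule Ck_on_SucI[OF \<open>open U\<close>])
    show "((\<lambda>q. L (f q)) has_derivative (\<lambda>v. L (frechet_derivative f (at p) v))) (at p)"
      if "p \<in> U" for p
      using Suc.prems that
      by (intro bounded_linear.has_derivative[OF L]) (auto simp: frechet_derivative_works[symmetric])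
    show "Ck_on k U (\<lambda>p. L (frechet_derivative f (at p) v))" for v
      using Suc.prems by (simp add: Suc.IH)
  qed
qed

text \<open>The reciprocal, and likewise the square root below, reappears in its own derivative, next to
  factors that are known to be of class \<open>C\<^sup>k\<close>; so the induction on \<open>k\<close> closes.\<close>

lemma Ck_on_inverse:
  fixes f :: "'a::euclidean_space \<Rightarrow> real"
  assumes "open U" "Ck_on k U f" "\<And>p. p \<in> U \<Longrightarrow> f p \<noteq> 0"
  shows "Ck_on k U (\<lambda>p. inverse (f p))"
  using assms(2)
proof (induction k)
  case 0
  then show ?case using assms(3) by (auto intro: continuous_on_inverse)
next
  case (Suc k)
  show ?case
  proof (rule Ck_on_SucI[OF \<open>open U\<close>])
    show "((\<lambda>q. inverse (f q)) has_derivative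
        (\<lambda>v. - (inverse (f p) * frechet_derivative f (at p) v * inverse (f p)))) (at p)"
      if "p \<in> U" for p
      using Suc.prems that assms(3)
      by (intro Deriv.has_derivative_inverse) (auto simp: frechet_derivative_works[symmetric])
    show "Ck_on k U (\<lambda>p. - (inverse (f p) * frechet_derivative f (at p) v * inverse (f p)))" for v
      using Suc.prems Suc.IH[OF Ck_on_Suc_imp_Ck_on[OF Suc.prems]]
      by (intro Ck_on_linear[OF bounded_linear_minus[OF bounded_linear_ident]]
          Ck_on_bilinear[OF bounded_bilinear_mult] \<open>open U\<close>) auto
  qed
qed

lemma Ck_on_sqrt:
  fixes f :: "'a::euclidean_space \<Rightarrow> real"
  assumes "open U" "Ck_on k U f" and pos: "\<And>p. p \<in> U \<Longrightarrow> f p > 0"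
  shows "Ck_on k U (\<lambda>p. sqrt (f p))"
  using assms(2)
proof (induction k)
  case 0
  then show ?case by (auto intro: continuous_on_real_sqrt)
next
  case (Suc k)
  have inv: "Ck_on k U (\<lambda>p. inverse (sqrt (f p)))"
    using Suc.IH[OF Ck_on_Suc_imp_Ck_on[OF Suc.prems]]
  proof (rule Ck_on_inverse[OF \<open>open U\<close>])
    show "sqrt (f p) \<noteq> 0" if "p \<in> U" for p using pos[OF that] by simp
  qed
  show ?case
  proof (rule Ck_on_SucI[OF \<open>open U\<close>])
    show "((\<lambda>q. sqrt (f q)) has_derivative
        (\<lambda>v. frechet_derivative f (at p) v * (inverse (sqrt (f p)) / 2))) (at p)"
      if "p \<in> U" for p
      using Suc.prems that pos
      by (intro has_derivative_real_sqrt) (auto simp: frechet_derivative_works[symmetric])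
    show "Ck_on k U (\<lambda>p. frechet_derivative f (at p) v * (inverse (sqrt (f p)) / 2))" for v
      using Suc.prems inv
      by (intro Ck_on_bilinear[OF bounded_bilinear_mult] Ck_on_linear[OF bounded_linear_divide]
          \<open>open U\<close>) auto
  qed
qed

lemma smooth_on_cong:
  "open U \<Longrightarrow> smooth_on U f \<Longrightarrow> (\<And>p. p \<in> U \<Longrightarrow> f p = g p) \<Longrightarrow> smooth_on U g"
  unfolding smooth_on_def using Ck_on_cong by blast

lemma smooth_on_subset: "smooth_on U f \<Longrightarrow> W \<subseteq> U \<Longrightarrow> smooth_on W f"
  unfolding smooth_on_def using Ck_on_subset by blast

lemma smooth_on_imp_continuous_on: "smooth_on U f \<Longrightarrow> continuous_on U f"
  unfolding smooth_on_def by (drule spec[of _ 0]) simp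

lemma smooth_on_has_derivative:
  "smooth_on U f \<Longrightarrow> p \<in> U \<Longrightarrow> (f has_derivative frechet_derivative f (at p)) (at p)"
  unfolding smooth_on_def frechet_derivative_works[symmetric] by (drule spec[of _ "Suc 0"]) simp

lemma smooth_on_partial:
  "smooth_on U f \<Longrightarrow> smooth_on U (\<lambda>p. frechet_derivative f (at p) v)"
  unfolding smooth_on_def
proof
  fix k
  assume "\<forall>k. Ck_on k U f"
  from spec[OF this, of "Suc k"] show "Ck_on k U (\<lambda>p. frechet_derivative f (at p) v)" by simp
qed

lemma smooth_on_const: "smooth_on U (\<lambda>p. c)"
  by (simp add: smooth_on_def Ck_on_const)

lemma smooth_on_add:
  "open U \<Longrightarrow> smooth_on U f \<Longrightarrow> smooth_on U g \<Longrightarrow> smooth_on U (\<lambda>p. f p + g p)"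
  by (simp add: smooth_on_def Ck_on_add)

lemma smooth_on_linear:
  "bounded_linear L \<Longrightarrow> open U \<Longrightarrow> smooth_on U f \<Longrightarrow> smooth_on U (\<lambda>p. L (f p))"
  by (simp add: smooth_on_def Ck_on_linear)

lemma smooth_on_bilinear:
  "bounded_bilinear B \<Longrightarrow> open U \<Longrightarrow> smooth_on U f \<Longrightarrow> smooth_on U g
    \<Longrightarrow> smooth_on U (\<lambda>p. B (f p) (g p))"
  by (simp add: smooth_on_def Ck_on_bilinear)

lemmas smooth_on_mult = smooth_on_bilinear[OF bounded_bilinear_mult]

lemma smooth_on_minus: "open U \<Longrightarrow> smooth_on U f \<Longrightarrow> smooth_on U (\<lambda>p. - f p)"
  by (rule smooth_on_linear[OF bounded_linear_minus[OF bounded_linear_ident]])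

lemma smooth_on_inverse:
  fixes f :: "'a::euclidean_space \<Rightarrow> real"
  shows "open U \<Longrightarrow> smooth_on U f \<Longrightarrow> (\<And>p. p \<in> U \<Longrightarrow> f p \<noteq> 0) \<Longrightarrow> smooth_on U (\<lambda>p. inverse (f p))"
  by (simp add: smooth_on_def Ck_on_inverse)

lemma smooth_on_sqrt:
  fixes f :: "'a::euclidean_space \<Rightarrow> real"
  shows "open U \<Longrightarrow> smooth_on U f \<Longrightarrow> (\<And>p. p \<in> U \<Longrightarrow> f p > 0) \<Longrightarrow> smooth_on U (\<lambda>p. sqrt (f p))"
  by (simp add: smooth_on_def Ck_on_sqrt)

lemma smooth_on_sum:
  assumes "open U" "\<And>i. i \<in> I \<Longrightarrow> smooth_on U (f i)"
  shows "smooth_on U (\<lambda>p. \<Sum>i\<in>I. f i p)"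
  using assms(2)
  by (induction I rule: infinite_finite_induct)
     (auto intro!: smooth_on_const smooth_on_add \<open>open U\<close>)

lemma frechet_derivative_expand:
  fixes f :: "'a::euclidean_space \<Rightarrow> 'b::real_normed_vector"
  assumes "smooth_on U f" "p \<in> U"
  shows "frechet_derivative f (at p) v = (\<Sum>b\<in>Basis. (v \<bullet> b) *\<^sub>R frechet_derivative f (at p) b)"
proof -
  have "linear (frechet_derivative f (at p))"
    using smooth_on_has_derivative[OF assms] by (rule has_derivative_linear)
  then have "frechet_derivative f (at p) (\<Sum>b\<in>Basis. (v \<bullet> b) *\<^sub>R b)
      = (\<Sum>b\<in>Basis. (v \<bullet> b) *\<^sub>R frechet_derivative f (at p) b)"
    by (simp add: linear_sum linear_scale)
  then show ?thesis by (simp add: euclidean_representation)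
qed

lemma smooth_on_directional:
  assumes "open U" "smooth_on U f" "smooth_on U Y"
  shows "smooth_on U (\<lambda>p. frechet_derivative f (at p) (Y p))"
proof (rule smooth_on_cong[OF \<open>open U\<close>])
  show "smooth_on U (\<lambda>p. \<Sum>b\<in>Basis. (Y p \<bullet> b) *\<^sub>R frechet_derivative f (at p) b)"
    by (intro smooth_on_sum smooth_on_bilinear[OF bounded_bilinear_scaleR]
        smooth_on_linear[OF bounded_linear_inner_left] smooth_on_partial assms)
qed (simp add: frechet_derivative_expand[OF assms(2), symmetric])

section \<open>Symmetry of the second derivative\<close>

text \<open>The second difference of \<open>f\<close> over the parallelogram spanned by \<open>s v\<close> and \<open>s w\<close> is \<open>s\<^sup>2\<close>
  times a value of the second derivative at a point of the parallelogram; the order of the two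
  applications of the mean value theorem decides which of the two mixed derivatives appears.\<close>

lemma second_difference_mean_value:
  fixes f :: "'a::euclidean_space \<Rightarrow> real"
  assumes f: "smooth_on U f" and s: "s > 0"
    and par: "\<And>x y. 0 \<le> x \<Longrightarrow> x \<le> s \<Longrightarrow> 0 \<le> y \<Longrightarrow> y \<le> s \<Longrightarrow> p + x *\<^sub>R v + y *\<^sub>R w \<in> U"
  shows "\<exists>x y. 0 \<le> x \<and> x \<le> s \<and> 0 \<le> y \<and> y \<le> s \<and>
    f (p + s *\<^sub>R v + s *\<^sub>R w) - f (p + s *\<^sub>R v) - f (p + s *\<^sub>R w) + f p
    = s * s * frechet_derivative (\<lambda>q. frechet_derivative f (at q) v) (at (p + x *\<^sub>R v + y *\<^sub>R w)) w"
proof -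
  let ?D = "\<lambda>q. frechet_derivative f (at q) v"
  have along_v: "((\<lambda>x. f (p + x *\<^sub>R v + y *\<^sub>R w)) has_real_derivative ?D (p + x *\<^sub>R v + y *\<^sub>R w)) (at x)"
    if "0 \<le> x" "x \<le> s" "0 \<le> y" "y \<le> s" for x y
  proof -
    have "((\<lambda>x. p + x *\<^sub>R v + y *\<^sub>R w) has_derivative (\<lambda>h. h *\<^sub>R v)) (at x)"
      by (auto intro!: derivative_eq_intros)
    from has_derivative_compose[OF this smooth_on_has_derivative[OF f par[OF that]]]
    show ?thesis
      using linear_scale[OF has_derivative_linear[OF smooth_on_has_derivative[OF f par[OF that]]]]
      by (simp add: has_field_derivative_def mult.commute[of _ "?D _"] fun_eq_iff mult_commute_abs)
  qed
  have along_w: "((\<lambda>y. ?D (p + x *\<^sub>R v + y *\<^sub>R w)) has_real_derivative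
      frechet_derivative ?D (at (p + x *\<^sub>R v + y *\<^sub>R w)) w) (at y)"
    if "0 \<le> x" "x \<le> s" "0 \<le> y" "y \<le> s" for x y
  proof -
    have "((\<lambda>y. p + x *\<^sub>R v + y *\<^sub>R w) has_derivative (\<lambda>h. h *\<^sub>R w)) (at y)"
      by (auto intro!: derivative_eq_intros)
    from has_derivative_compose[OF this smooth_on_has_derivative[OF smooth_on_partial[OF f] par[OF that]]]
    show ?thesis
      using linear_scale[OF has_derivative_linear[OF smooth_on_has_derivative[OF smooth_on_partial[OF f] par[OF that]]]]
      by (simp add: has_field_derivative_def fun_eq_iff mult_commute_abs)
  qed
  let ?g = "\<lambda>x. f (p + x *\<^sub>R v + s *\<^sub>R w) - f (p + x *\<^sub>R v)"
  have "\<exists>x. 0 < x \<and> x < s \<and> ?g s - ?g 0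
      = (s - 0) * (?D (p + x *\<^sub>R v + s *\<^sub>R w) - ?D (p + x *\<^sub>R v + 0 *\<^sub>R w))"
    using s along_v[of _ s] along_v[of _ 0] by (intro MVT2) (auto intro!: DERIV_diff)
  then obtain x where x: "0 < x" "x < s"
    "?g s - ?g 0 = s * (?D (p + x *\<^sub>R v + s *\<^sub>R w) - ?D (p + x *\<^sub>R v + 0 *\<^sub>R w))" by auto
  have "\<exists>y. 0 < y \<and> y < s \<and> ?D (p + x *\<^sub>R v + s *\<^sub>R w) - ?D (p + x *\<^sub>R v + 0 *\<^sub>R w)
      = (s - 0) * frechet_derivative ?D (at (p + x *\<^sub>R v + y *\<^sub>R w)) w"
    using s x along_w[of x] by (intro MVT2) auto
  then obtain y where "0 < y" "y < s"
    "?D (p + x *\<^sub>R v + s *\<^sub>R w) - ?D (p + x *\<^sub>R v + 0 *\<^sub>R w)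
      = s * frechet_derivative ?D (at (p + x *\<^sub>R v + y *\<^sub>R w)) w" by auto
  with x show ?thesis by (intro exI[of _ x] exI[of _ y]) auto
qed

text \<open>On a small parallelogram the two mean value formulas express the same second difference, so the
  two mixed derivatives take equal values at points arbitrarily close to \<open>p\<close>; by continuity they agree
  at \<open>p\<close>.\<close>

lemma symmetric_second_derivative_real:
  fixes f :: "'a::euclidean_space \<Rightarrow> real"
  assumes U: "open U" and f: "smooth_on U f" and p: "p \<in> U"
  shows "frechet_derivative (\<lambda>q. frechet_derivative f (at q) v) (at p) w
       = frechet_derivative (\<lambda>q. frechet_derivative f (at q) w) (at p) v"
proof (rule ccontr)
  define P where "P = (\<lambda>q. frechet_derivative (\<lambda>q. frechet_derivative f (at q) v) (at q) w)"
  define Q where "Q = (\<lambda>q. frechet_derivative (\<lambda>q. frechet_derivative f (at q) w) (at q) v)"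
  assume "\<not> ?thesis"
  then have "P p - Q p \<noteq> 0" by (simp add: P_def Q_def)
  define e where "e = \<bar>P p - Q p\<bar> / 2"
  have e: "e > 0" using \<open>P p - Q p \<noteq> 0\<close> by (simp add: e_def)
  have "continuous_on U P" "continuous_on U Q"
    unfolding P_def Q_def
    by (intro smooth_on_imp_continuous_on smooth_on_partial f)+
  then obtain d1 d2 where d1: "d1 > 0" "\<And>q. dist q p < d1 \<Longrightarrow> dist (P q) (P p) < e"
    and d2: "d2 > 0" "\<And>q. dist q p < d2 \<Longrightarrow> dist (Q q) (Q p) < e"
    using e U p unfolding continuous_on_eq_continuous_at[OF U] continuous_at_eps_delta
    by meson
  obtain d3 where d3: "d3 > 0" "\<And>q. dist q p < d3 \<Longrightarrow> q \<in> U"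
    using U p unfolding open_dist by blast
  define d where "d = min d1 (min d2 d3)"
  have d: "d > 0" using d1 d2 d3 by (simp add: d_def)
  define s where "s = d / (2 * (norm v + norm w + 1))"
  have s: "s > 0" using d by (auto simp: s_def add_nonneg_pos intro!: divide_pos_pos)
  have small: "dist (p + x *\<^sub>R v + y *\<^sub>R w) p < d" if "0 \<le> x" "x \<le> s" "0 \<le> y" "y \<le> s" for x y
  proof -
    have "dist (p + x *\<^sub>R v + y *\<^sub>R w) p \<le> x * norm v + y * norm w"
      using that norm_triangle_ineq[of "x *\<^sub>R v" "y *\<^sub>R w"] by (simp add: dist_norm algebra_simps)
    also have "\<dots> \<le> s * norm v + s * norm w"
      using that by (intro add_mono mult_right_mono) auto
    also have "\<dots> < s * (norm v + norm w + 1)" using s by (simp add: algebra_simps)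
    also have "\<dots> = d / 2"
      using add_nonneg_pos[of "norm v + norm w" 1] by (simp add: s_def field_simps)
    finally show ?thesis using d by simp
  qed
  have inU: "p + x *\<^sub>R v + y *\<^sub>R w \<in> U" "p + y *\<^sub>R w + x *\<^sub>R v \<in> U"
    if "0 \<le> x" "x \<le> s" "0 \<le> y" "y \<le> s" for x y
    using d3 small[OF that] by (auto simp: d_def algebra_simps)
  obtain x y where 1: "0 \<le> x" "x \<le> s" "0 \<le> y" "y \<le> s"
    "f (p + s *\<^sub>R v + s *\<^sub>R w) - f (p + s *\<^sub>R v) - f (p + s *\<^sub>R w) + f p
      = s * s * P (p + x *\<^sub>R v + y *\<^sub>R w)"
    using second_difference_mean_value[OF f s, of p v w] inU by (auto simp: P_def)
  obtain y' x' where 2: "0 \<le> x'" "x' \<le> s" "0 \<le> y'" "y' \<le> s"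
    "f (p + s *\<^sub>R w + s *\<^sub>R v) - f (p + s *\<^sub>R w) - f (p + s *\<^sub>R v) + f p
      = s * s * Q (p + y' *\<^sub>R w + x' *\<^sub>R v)"
    using second_difference_mean_value[OF f s, of p w v] inU by (auto simp: Q_def)
  have "s * s * P (p + x *\<^sub>R v + y *\<^sub>R w) = s * s * Q (p + x' *\<^sub>R v + y' *\<^sub>R w)"
    using 1(5) 2(5) by (simp add: algebra_simps)
  then have "P (p + x *\<^sub>R v + y *\<^sub>R w) = Q (p + x' *\<^sub>R v + y' *\<^sub>R w)" using s by simp
  moreover have "dist (P (p + x *\<^sub>R v + y *\<^sub>R w)) (P p) < e"
    using small[OF 1(1-4)] by (intro d1) (simp add: d_def)
  moreover have "dist (Q (p + x' *\<^sub>R v + y' *\<^sub>R w)) (Q p) < e"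
    using small[OF 2(1-4)] by (intro d2) (simp add: d_def)
  ultimately have "dist (P p) (Q p) < \<bar>P p - Q p\<bar>"
    unfolding e_def by (metis dist_commute dist_triangle_half_l)
  then show False by (simp add: dist_real_def)
qed

lemma frechet_derivative_linear:
  assumes "bounded_linear L" "smooth_on U f" "p \<in> U"
  shows "frechet_derivative (\<lambda>q. L (f q)) (at p) v = L (frechet_derivative f (at p) v)"
  by (simp add: frechet_derivative_at[OF bounded_linear.has_derivative[OF assms(1)
      smooth_on_has_derivative[OF assms(2,3)]], symmetric])

lemma symmetric_second_derivative:
  fixes f :: "'a::euclidean_space \<Rightarrow> 'b::euclidean_space"
  assumes U: "open U" and f: "smooth_on U f" and p: "p \<in> U"
  shows "frechet_derivative (\<lambda>q. frechet_derivative f (at q) v) (at p) w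
       = frechet_derivative (\<lambda>q. frechet_derivative f (at q) w) (at p) v"
proof (rule euclidean_eqI)
  fix b :: 'b
  let ?L = "\<lambda>x::'b. x \<bullet> b"
  have *: "frechet_derivative (\<lambda>q. frechet_derivative f (at q) v) (at p) w \<bullet> b
      = frechet_derivative (\<lambda>q. frechet_derivative (\<lambda>q. f q \<bullet> b) (at q) v) (at p) w" for v w
  proof -
    have "frechet_derivative (\<lambda>q. frechet_derivative f (at q) v) (at p) w \<bullet> b
        = frechet_derivative (\<lambda>q. frechet_derivative f (at q) v \<bullet> b) (at p) w"
      by (rule frechet_derivative_linear[OF bounded_linear_inner_left smooth_on_partial[OF f] p, symmetric])
    also have "frechet_derivative (\<lambda>q. frechet_derivative f (at q) v \<bullet> b) (at p)
        = frechet_derivative (\<lambda>q. frechet_derivative (\<lambda>q. f q \<bullet> b) (at q) v) (at p)"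
      using smooth_on_has_derivative[OF smooth_on_linear[OF bounded_linear_inner_left U smooth_on_partial[OF f]] p]
      by (intro frechet_derivative_transform_within_open[OF _ U p])
        (auto simp: differentiable_def frechet_derivative_linear[OF bounded_linear_inner_left f])
    finally show ?thesis .
  qed
  show "frechet_derivative (\<lambda>q. frechet_derivative f (at q) v) (at p) w \<bullet> b
      = frechet_derivative (\<lambda>q. frechet_derivative f (at q) w) (at p) v \<bullet> b"
    unfolding * by (rule symmetric_second_derivative_real[OF U
        smooth_on_linear[OF bounded_linear_inner_left U f] p])
qed

section \<open>Derivatives along vector fields\<close>

lemma smooth_on_vf_deriv:
  "open U \<Longrightarrow> smooth_on U Y \<Longrightarrow> smooth_on U f \<Longrightarrow> smooth_on U (vf_deriv Y f)"
  using smooth_on_directional[of U f Y] by (simp add: vf_deriv_def[abs_def])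

lemma vf_deriv_cong:
  assumes "open U" "smooth_on U f" "\<And>q. q \<in> U \<Longrightarrow> f q = g q" "p \<in> U"
  shows "vf_deriv Y f p = vf_deriv Y g p"
proof -
  have "frechet_derivative f (at p) = frechet_derivative g (at p)"
    using smooth_on_has_derivative[OF assms(2,4)] assms
    by (intro frechet_derivative_transform_within_open[OF _ \<open>open U\<close>]) (auto simp: differentiable_def)
  then show ?thesis by (simp add: vf_deriv_def)
qed

lemma vf_deriv_const: "vf_deriv Y (\<lambda>q. c) p = 0"
  by (simp add: vf_deriv_def)

lemma vf_deriv_linear:
  "bounded_linear L \<Longrightarrow> smooth_on U f \<Longrightarrow> p \<in> U \<Longrightarrow>
    vf_deriv Y (\<lambda>q. L (f q)) p = L (vf_deriv Y f p)"
  by (simp add: vf_deriv_def frechet_derivative_linear)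

lemma vf_deriv_add:
  assumes "smooth_on U f" "smooth_on U g" "p \<in> U"
  shows "vf_deriv Y (\<lambda>q. f q + g q) p = vf_deriv Y f p + vf_deriv Y g p"
  unfolding vf_deriv_def
  by (simp add: frechet_derivative_at[OF has_derivative_add[OF smooth_on_has_derivative[OF assms(1,3)]
      smooth_on_has_derivative[OF assms(2,3)]], symmetric])

lemma vf_deriv_bilinear:
  assumes "bounded_bilinear B" "smooth_on U f" "smooth_on U g" "p \<in> U"
  shows "vf_deriv Y (\<lambda>q. B (f q) (g q)) p = B (f p) (vf_deriv Y g p) + B (vf_deriv Y f p) (g p)"
  unfolding vf_deriv_def
  by (simp add: frechet_derivative_at[OF bounded_bilinear.FDERIV[OF assms(1) smooth_on_has_derivative[OF assms(2,4)]
      smooth_on_has_derivative[OF assms(3,4)]], symmetric])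

lemma vf_deriv_sum:
  assumes "\<And>i. i \<in> I \<Longrightarrow> smooth_on U (f i)" "p \<in> U" "open U"
  shows "vf_deriv Y (\<lambda>q. \<Sum>i\<in>I. f i q) p = (\<Sum>i\<in>I. vf_deriv Y (f i) p)"
  using assms(1)
proof (induction I rule: infinite_finite_induct)
  case (insert i I)
  then show ?case
    using vf_deriv_add[OF insert.prems[of i] smooth_on_sum[OF \<open>open U\<close>, of I f] \<open>p \<in> U\<close>, of Y]
    by simp
qed (simp_all add: vf_deriv_const)

text \<open>Differentiating along \<open>Y\<close> the derivative along \<open>Z\<close> produces a first-order term, from the change
  of \<open>Z\<close>, and a Hessian term, which is written as a double sum because its symmetry in \<open>Y\<close> and \<open>Z\<close>
  is what the next lemma uses.\<close>

lemma second_vf_deriv: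
  fixes f :: "real^2 \<Rightarrow> 'b::real_normed_vector"
  assumes U: "open U" and f: "smooth_on U f" and Z: "smooth_on U Z" and p: "p \<in> U"
  shows "vf_deriv Y (vf_deriv Z f) p = vf_deriv (vf_deriv Y Z) f p
    + (\<Sum>b\<in>Basis. \<Sum>c\<in>Basis. ((Z p \<bullet> b) * (Y p \<bullet> c)) *\<^sub>R
        frechet_derivative (\<lambda>q. frechet_derivative f (at q) b) (at p) c)"
proof -
  have Zb: "smooth_on U (\<lambda>q. Z q \<bullet> b)" for b
    by (rule smooth_on_linear[OF bounded_linear_inner_left U Z])
  have "vf_deriv Y (vf_deriv Z f) p = vf_deriv Y (\<lambda>q. \<Sum>b\<in>Basis. (Z q \<bullet> b) *\<^sub>R frechet_derivative f (at q) b) p"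
    by (intro vf_deriv_cong[OF U smooth_on_vf_deriv[OF U Z f] _ p])
      (simp add: vf_deriv_def frechet_derivative_expand[OF f, symmetric])
  also have "\<dots> = (\<Sum>b\<in>Basis. vf_deriv Y (\<lambda>q. (Z q \<bullet> b) *\<^sub>R frechet_derivative f (at q) b) p)"
    by (intro vf_deriv_sum[OF _ p U] smooth_on_bilinear[OF bounded_bilinear_scaleR U Zb] smooth_on_partial f)
  also have "\<dots> = (\<Sum>b\<in>Basis. (Z p \<bullet> b) *\<^sub>R frechet_derivative (\<lambda>q. frechet_derivative f (at q) b) (at p) (Y p)
      + (vf_deriv Y Z p \<bullet> b) *\<^sub>R frechet_derivative f (at p) b)"
    by (intro sum.cong refl)
      (simp add: vf_deriv_bilinear[OF bounded_bilinear_scaleR Zb smooth_on_partial[OF f] p]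
        vf_deriv_linear[OF bounded_linear_inner_left Z p], simp add: vf_deriv_def)
  also have "\<dots> = vf_deriv (vf_deriv Y Z) f p
      + (\<Sum>b\<in>Basis. (Z p \<bullet> b) *\<^sub>R frechet_derivative (\<lambda>q. frechet_derivative f (at q) b) (at p) (Y p))"
    by (simp add: sum.distrib frechet_derivative_expand[OF f p, of "vf_deriv Y Z p"]
        vf_deriv_def[of "vf_deriv Y Z"])
  finally show ?thesis
    by (simp add: frechet_derivative_expand[OF smooth_on_partial[OF f] p, of _ "Y p"] scaleR_sum_right)
qed

lemma vf_deriv_commutator:
  fixes f :: "real^2 \<Rightarrow> 'b::euclidean_space"
  assumes U: "open U" and f: "smooth_on U f" and Y: "smooth_on U Y" and Z: "smooth_on U Z" and p: "p \<in> U"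
  shows "vf_deriv Y (vf_deriv Z f) p - vf_deriv Z (vf_deriv Y f) p
    = vf_deriv (vf_deriv Y Z) f p - vf_deriv (vf_deriv Z Y) f p"
proof -
  have "(\<Sum>b\<in>Basis. \<Sum>c\<in>Basis. ((Z p \<bullet> b) * (Y p \<bullet> c)) *\<^sub>R
        frechet_derivative (\<lambda>q. frechet_derivative f (at q) b) (at p) c)
      = (\<Sum>b\<in>Basis. \<Sum>c\<in>Basis. ((Y p \<bullet> b) * (Z p \<bullet> c)) *\<^sub>R
        frechet_derivative (\<lambda>q. frechet_derivative f (at q) b) (at p) c)"
  proof (rule trans[OF sum.swap], intro sum.cong refl)
    fix b c :: "real^2"
    show "((Z p \<bullet> c) * (Y p \<bullet> b)) *\<^sub>R
          frechet_derivative (\<lambda>q. frechet_derivative f (at q) c) (at p) b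
        = ((Y p \<bullet> b) * (Z p \<bullet> c)) *\<^sub>R
          frechet_derivative (\<lambda>q. frechet_derivative f (at q) b) (at p) c"
      unfolding symmetric_second_derivative[OF U f p, of c b] mult.commute[of "Z p \<bullet> c"] ..
  qed
  then show ?thesis
    by (simp only: second_vf_deriv[OF U f Z p, of Y] second_vf_deriv[OF U f Y p, of Z]
        add_diff_cancel_right)
qed

section \<open>Maps to the complex quadric with null derivatives\<close>

text \<open>The functions \<open>a, b\<close> are the connection coefficients of a null frame, and \<open>L\<close> is the Laplace
  operator of the surface. With the bilinear product \<open>v \<cdot> w = \<Sum>i. v\<^sub>i w\<^sub>i\<close>, the derivatives of \<open>N\<close> are
  orthogonal to \<open>N\<close>, and
  \<open>\<mu> \<phi> N = L (\<phi> N) = (L \<phi> + \<phi>\<^sup>2) N + 2 (D\<^sub>1\<phi> D\<^sub>2N + D\<^sub>2\<phi> D\<^sub>1N)\<close>.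
  Multiplication by \<open>N\<close> gives \<open>\<mu> \<phi> = L \<phi> + \<phi>\<^sup>2\<close> and hence \<open>D\<^sub>1\<phi> D\<^sub>2N + D\<^sub>2\<phi> D\<^sub>1N = 0\<close>. As the derivatives
  of \<open>N\<close> are null and \<open>D\<^sub>1N \<cdot> D\<^sub>2N = - \<phi> / 2\<close>, multiplication of the latter by \<open>D\<^sub>1N\<close> and by \<open>D\<^sub>2N\<close> gives
  \<open>\<phi> D\<^sub>1\<phi> = \<phi> D\<^sub>2\<phi> = 0\<close>. So \<open>L \<phi> = 0\<close> wherever \<open>\<phi> \<noteq> 0\<close>.\<close>

lemma null_gauss_map_dichotomy:
  fixes N :: "'i \<Rightarrow> real^2 \<Rightarrow> complex" and \<phi> a b :: "real^2 \<Rightarrow> complex" and \<mu> :: complex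
  assumes W: "open W" and f1: "smooth_on W f1" and f2: "smooth_on W f2"
    and N: "\<And>i. smooth_on W (N i)" and \<phi>: "smooth_on W \<phi>"
    and L1: "\<And>g p. smooth_on W g \<Longrightarrow> p \<in> W \<Longrightarrow>
        L g p = 2 * (vf_deriv f1 (vf_deriv f2 g) p - b p * vf_deriv f2 g p)"
    and L2: "\<And>g p. smooth_on W g \<Longrightarrow> p \<in> W \<Longrightarrow>
        L g p = 2 * (vf_deriv f2 (vf_deriv f1 g) p - a p * vf_deriv f1 g p)"
    and unit: "\<And>p. p \<in> W \<Longrightarrow> (\<Sum>i\<in>I. N i p * N i p) = 1"
    and null1: "\<And>p. p \<in> W \<Longrightarrow> (\<Sum>i\<in>I. vf_deriv f1 (N i) p * vf_deriv f1 (N i) p) = 0"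
    and null2: "\<And>p. p \<in> W \<Longrightarrow> (\<Sum>i\<in>I. vf_deriv f2 (N i) p * vf_deriv f2 (N i) p) = 0"
    and LN: "\<And>i p. i \<in> I \<Longrightarrow> p \<in> W \<Longrightarrow> L (N i) p = \<phi> p * N i p"
    and LLN: "\<And>i p. i \<in> I \<Longrightarrow> p \<in> W \<Longrightarrow> L (\<lambda>q. \<phi> q * N i q) p = \<mu> * (\<phi> p * N i p)"
    and p: "p \<in> W"
  shows "\<phi> p = 0 \<or> \<phi> p = \<mu>"
proof -
  let ?D1 = "vf_deriv f1" and ?D2 = "vf_deriv f2"
  note mult = vf_deriv_bilinear[OF bounded_bilinear_mult, of W]
  note sm = W f1 f2 N \<phi> smooth_on_mult smooth_on_vf_deriv smooth_on_add
  have tangential: "(\<Sum>i\<in>I. N i q * vf_deriv Y (N i) q) = 0" if q: "q \<in> W" for Y q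
  proof -
    have "0 = vf_deriv Y (\<lambda>q. 1::complex) q" by (simp add: vf_deriv_const)
    also have "\<dots> = vf_deriv Y (\<lambda>q. \<Sum>i\<in>I. N i q * N i q) q"
      by (rule vf_deriv_cong[OF W smooth_on_const _ q]) (simp add: unit)
    also have "\<dots> = (\<Sum>i\<in>I. N i q * vf_deriv Y (N i) q + vf_deriv Y (N i) q * N i q)"
      using q by (subst vf_deriv_sum[where U = W]) (auto simp: mult sm)
    also have "\<dots> = 2 * (\<Sum>i\<in>I. N i q * vf_deriv Y (N i) q)"
      by (simp add: sum_distrib_left mult.commute)
    finally show ?thesis by simp
  qed
  define P where "P q = (\<Sum>i\<in>I. ?D1 (N i) q * ?D2 (N i) q)" for q
  have P: "P q = - (\<phi> q / 2)" if q: "q \<in> W" for q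
  proof -
    have "0 = vf_deriv f2 (\<lambda>q. 0::complex) q" by (simp add: vf_deriv_const)
    also have "\<dots> = vf_deriv f2 (\<lambda>q. \<Sum>i\<in>I. N i q * ?D1 (N i) q) q"
      by (rule vf_deriv_cong[OF W smooth_on_const _ q]) (simp add: tangential)
    also have "\<dots> = (\<Sum>i\<in>I. N i q * ?D2 (?D1 (N i)) q + ?D2 (N i) q * ?D1 (N i) q)"
      using q by (subst vf_deriv_sum[where U = W]) (auto simp: mult sm)
    also have "\<dots> = (\<Sum>i\<in>I. \<phi> q / 2 * (N i q * N i q) + a q * (N i q * ?D1 (N i) q)
        + ?D1 (N i) q * ?D2 (N i) q)"
    proof (rule sum.cong[OF refl])
      fix i assume i: "i \<in> I"
      have "?D2 (?D1 (N i)) q = \<phi> q / 2 * N i q + a q * ?D1 (N i) q"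
        using L2[OF N q, of i] LN[OF i q] by (simp add: field_simps)
      then show "N i q * ?D2 (?D1 (N i)) q + ?D2 (N i) q * ?D1 (N i) q
        = \<phi> q / 2 * (N i q * N i q) + a q * (N i q * ?D1 (N i) q) + ?D1 (N i) q * ?D2 (N i) q"
        by (simp add: algebra_simps)
    qed
    also have "\<dots> = \<phi> q / 2 + P q"
      by (simp add: sum.distrib P_def unit[OF q] tangential[OF q]
          sum_distrib_left[symmetric] sum_divide_distrib[symmetric])
    finally show ?thesis by (simp add: eq_neg_iff_add_eq_0 add.commute)
  qed
  have expand: "\<mu> * (\<phi> q * N i q) = L \<phi> q * N i q + \<phi> q * (\<phi> q * N i q)
      + 2 * (?D1 \<phi> q * ?D2 (N i) q + ?D2 \<phi> q * ?D1 (N i) q)" if q: "q \<in> W" and i: "i \<in> I" for q i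
  proof -
    have "?D1 (?D2 (\<lambda>q. \<phi> q * N i q)) q = ?D1 (\<lambda>q. \<phi> q * ?D2 (N i) q + ?D2 \<phi> q * N i q) q"
      by (rule vf_deriv_cong[OF W _ _ q]) (simp_all add: mult sm)
    also have "\<dots> = \<phi> q * ?D1 (?D2 (N i)) q + ?D1 \<phi> q * ?D2 (N i) q
        + (?D2 \<phi> q * ?D1 (N i) q + ?D1 (?D2 \<phi>) q * N i q)"
      by (subst vf_deriv_add[where U = W]) (simp_all add: mult sm q)
    finally have "L (\<lambda>q. \<phi> q * N i q) q = L \<phi> q * N i q + \<phi> q * L (N i) q
        + 2 * (?D1 \<phi> q * ?D2 (N i) q + ?D2 \<phi> q * ?D1 (N i) q)"
      by (simp add: L1 sm q mult algebra_simps)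
    then show ?thesis by (simp add: LN LLN q i)
  qed
  have radial: "\<mu> * \<phi> q = L \<phi> q + \<phi> q * \<phi> q" if q: "q \<in> W" for q
  proof -
    have "\<mu> * \<phi> q = (\<Sum>i\<in>I. \<mu> * (\<phi> q * N i q) * N i q)"
      using unit[OF q] by (simp add: mult.assoc sum_distrib_left[symmetric])
    also have "\<dots> = (\<Sum>i\<in>I. (L \<phi> q + \<phi> q * \<phi> q) * (N i q * N i q)
        + 2 * ?D1 \<phi> q * (N i q * ?D2 (N i) q) + 2 * ?D2 \<phi> q * (N i q * ?D1 (N i) q))"
      by (rule sum.cong[OF refl], subst expand[OF q]) (simp_all add: algebra_simps)
    also have "\<dots> = L \<phi> q + \<phi> q * \<phi> q"
      by (simp add: sum.distrib sum_distrib_left[symmetric] unit[OF q] tangential[OF q])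
    finally show ?thesis .
  qed
  have cross: "?D1 \<phi> q * ?D2 (N i) q + ?D2 \<phi> q * ?D1 (N i) q = 0" if q: "q \<in> W" and i: "i \<in> I" for q i
  proof -
    have "\<mu> * (\<phi> q * N i q) = (L \<phi> q + \<phi> q * \<phi> q) * N i q"
      by (simp only: radial[OF q, symmetric] mult.assoc)
    then have "2 * (?D1 \<phi> q * ?D2 (N i) q + ?D2 \<phi> q * ?D1 (N i) q) = 0"
      using expand[OF q i] by (simp add: algebra_simps)
    then show ?thesis unfolding mult_eq_0_iff by simp
  qed
  have D2: "?D2 \<phi> q * \<phi> q = 0" if q: "q \<in> W" for q
  proof -
    have "0 = (\<Sum>i\<in>I. (?D1 \<phi> q * ?D2 (N i) q + ?D2 \<phi> q * ?D1 (N i) q) * ?D2 (N i) q)"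
      by (simp add: cross[OF q])
    also have "\<dots> = (\<Sum>i\<in>I. ?D1 \<phi> q * (?D2 (N i) q * ?D2 (N i) q) + ?D2 \<phi> q * (?D1 (N i) q * ?D2 (N i) q))"
      by (simp add: algebra_simps)
    also have "\<dots> = ?D2 \<phi> q * P q"
      by (simp add: sum.distrib sum_distrib_left[symmetric] null2[OF q] P_def)
    finally show ?thesis by (simp add: P[OF q])
  qed
  have D1: "?D1 \<phi> q * \<phi> q = 0" if q: "q \<in> W" for q
  proof -
    have "0 = (\<Sum>i\<in>I. (?D1 \<phi> q * ?D2 (N i) q + ?D2 \<phi> q * ?D1 (N i) q) * ?D1 (N i) q)"
      by (simp add: cross[OF q])
    also have "\<dots> = (\<Sum>i\<in>I. ?D1 \<phi> q * (?D1 (N i) q * ?D2 (N i) q) + ?D2 \<phi> q * (?D1 (N i) q * ?D1 (N i) q))"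
      by (simp add: algebra_simps)
    also have "\<dots> = ?D1 \<phi> q * P q"
      by (simp add: sum.distrib sum_distrib_left[symmetric] null1[OF q] P_def)
    finally show ?thesis by (simp add: P[OF q])
  qed
  \<comment> \<open>Differentiating the product \<open>\<phi> D\<^sub>2\<phi> = 0\<close> once more shows that \<open>D\<^sub>1 D\<^sub>2 \<phi>\<close> also vanishes where \<open>\<phi>\<close> does not.\<close>
  have "0 = ?D1 (\<lambda>q. 0::complex) p" by (simp add: vf_deriv_const)
  also have "\<dots> = ?D1 (\<lambda>q. ?D2 \<phi> q * \<phi> q) p"
    by (rule vf_deriv_cong[OF W smooth_on_const _ p]) (simp add: D2)
  also have "\<dots> = ?D2 \<phi> p * ?D1 \<phi> p + ?D1 (?D2 \<phi>) p * \<phi> p"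
    by (simp add: mult sm p)
  finally have D12: "?D2 \<phi> p * ?D1 \<phi> p + ?D1 (?D2 \<phi>) p * \<phi> p = 0" ..
  show ?thesis
  proof (cases "\<phi> p = 0")
    case False
    then have "?D1 \<phi> p = 0" "?D2 \<phi> p = 0" "?D1 (?D2 \<phi>) p = 0"
      using D1[OF p] D2[OF p] D12 by auto
    then have "L \<phi> p = 0" by (simp add: L1[OF \<phi> p])
    then show ?thesis using radial[OF p] False by simp
  qed simp
qed

section \<open>Existence of pseudo-orthonormal frames\<close>

lemma bounded_bilinear_mink: "bounded_bilinear mink"
  unfolding bilinear_conv_bounded_bilinear[symmetric] bilinear_def mink_def
  by (auto intro!: linearI simp: algebra_simps)

lemma mink_commute: "mink a b = mink b a"
  by (simp add: mink_def)

text \<open>If the determinant of the Gram matrix vanished, the form would be degenerate; if it were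
  positive, completing the square would make the form definite, so that its index would be 0 or 2.\<close>

lemma gram_determinant_negative:
  fixes B :: "real^2 \<Rightarrow> real^2 \<Rightarrow> real"
  assumes B: "\<And>v w. B v w = E * (v$1 * w$1) + F * (v$1 * w$2 + v$2 * w$1) + G * (v$2 * w$2)"
    and nondeg: "nondegenerate B" and idx: "form_index B = 1"
  shows "F * F - E * G > 0"
proof (rule ccontr)
  assume "\<not> ?thesis"
  then consider "F * F = E * G" | "F * F < E * G" by linarith
  then show False
  proof cases
    case 1
    show False
    proof (cases "E = 0")
      case True
      then have "B (axis 1 1) w = 0" for w using 1 by (simp add: B axis_def)
      then have "(axis 1 1 :: real^2) = 0" using nondeg unfolding nondegenerate_def by blast
      then show False by simp
    next
      case False
      have "B (vector [- F, E]) w = 0" for w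
      proof -
        have "B (vector [- F, E]) w = (E * G - F * F) * w$2" by (simp add: B algebra_simps)
        then show ?thesis using 1 by simp
      qed
      then have "(vector [- F, E] :: real^2) = 0" using nondeg by (auto simp: nondegenerate_def)
      then have "(vector [- F, E] :: real^2) $ 2 = 0" by simp
      then show False using False by simp
    qed
  next
    case 2
    let ?S = "{dim W | W. subspace W \<and> (\<forall>w\<in>W. w \<noteq> 0 \<longrightarrow> B w w < 0)}"
    have "?S \<subseteq> {..2}" using dim_subset_UNIV_cart[where 'n = 2] by auto
    then have fin: "finite ?S" by (rule finite_subset) simp
    have "subspace {0::real^2}" by (rule subspace_single_0)
    then have "?S \<noteq> {}" by blast
    then have "1 \<in> ?S" using Max_in[OF fin] idx by (simp add: form_index_def)
    then obtain W where W: "dim W = 1" "\<And>w. w \<in> W \<Longrightarrow> w \<noteq> 0 \<Longrightarrow> B w w < 0" by auto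
    have "\<not> W \<subseteq> {0}" using W(1) dim_eq_0[of W] by simp
    then obtain v where v: "B v v < 0" using W(2) by blast
    have square: "E * B w w = (E * w$1 + F * w$2)\<^sup>2 + (E * G - F * F) * (w$2)\<^sup>2" for w
      by (simp add: B power2_eq_square algebra_simps)
    have "E \<noteq> 0" using 2 by auto
    have "0 \<le> E * B v v" unfolding square using 2 by (intro add_nonneg_nonneg) auto
    then have "E < 0" using v \<open>E \<noteq> 0\<close> by (simp add: zero_le_mult_iff)
    have "B w w < 0" if "w \<noteq> 0" for w
    proof -
      have "0 < E * B w w"
      proof (cases "w$2 = 0")
        case True
        then have "w$1 \<noteq> 0" using that by (metis exhaust_2 vec_eq_iff zero_index)
        then show ?thesis unfolding square using True \<open>E \<noteq> 0\<close> by simp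
      next
        case False
        then show ?thesis unfolding square using 2 by (intro add_nonneg_pos) auto
      qed
      then show ?thesis using \<open>E < 0\<close> by (simp add: zero_less_mult_iff)
    qed
    then have "2 \<in> ?S" by (intro CollectI exI[of _ UNIV]) simp
    then have "2 \<le> form_index B" unfolding form_index_def by (rule Max_ge[OF fin])
    then show False using idx by simp
  qed
qed

lemma first_form_coordinates:
  assumes "smooth_on U X" "p \<in> U"
  shows "first_form X p v w = first_form X p (axis 1 1) (axis 1 1) * (v$1 * w$1)
    + first_form X p (axis 1 1) (axis 2 1) * (v$1 * w$2 + v$2 * w$1)
    + first_form X p (axis 2 1) (axis 2 1) * (v$2 * w$2)"
proof -
  have lin: "linear (frechet_derivative X (at p))"
    using smooth_on_has_derivative[OF assms] by (rule has_derivative_linear)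
  have "frechet_derivative X (at p) v = v$1 *\<^sub>R frechet_derivative X (at p) (axis 1 1)
      + v$2 *\<^sub>R frechet_derivative X (at p) (axis 2 1)" for v
  proof -
    have "v = v$1 *\<^sub>R axis 1 1 + v$2 *\<^sub>R axis 2 1"
      by (simp add: vec_eq_iff forall_2 axis_def)
    then have "frechet_derivative X (at p) v
        = frechet_derivative X (at p) (v$1 *\<^sub>R axis 1 1 + v$2 *\<^sub>R axis 2 1)" by simp
    then show ?thesis by (simp add: linear_add[OF lin] linear_scale[OF lin])
  qed
  from this[of v] this[of w] show ?thesis
    by (simp add: first_form_def mink_def algebra_simps)
qed

lemma smooth_on_first_form:
  assumes "open U" "smooth_on U X"
  shows "smooth_on U (\<lambda>p. first_form X p v w)"
  unfolding first_form_def
  by (intro smooth_on_bilinear[OF bounded_bilinear_mink] smooth_on_partial assms)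

text \<open>For a square root \<open>\<sigma>\<close> of the negative Gram determinant \<open>F\<^sup>2 - E G\<close>, the equations
  \<open>(\<sigma> - F) (\<sigma> + F) = - E G\<close> make \<open>(\<sigma> - F, E)\<close> and \<open>(G, \<sigma> - F)\<close> null vectors. The second
  is rescaled to make their product \<open>-1\<close>. The sign of \<open>\<sigma>\<close> decides the orientation.\<close>

lemma null_frame_of_square_root:
  fixes X :: "real^2 \<Rightarrow> real^4" and \<sigma> :: "real^2 \<Rightarrow> real"
  defines "E \<equiv> \<lambda>p. first_form X p (axis 1 1) (axis 1 1)"
    and "F \<equiv> \<lambda>p. first_form X p (axis 1 1) (axis 2 1)"
    and "G \<equiv> \<lambda>p. first_form X p (axis 2 1) (axis 2 1)"
  assumes W: "open W" and X: "smooth_on W X" and \<sigma>: "smooth_on W \<sigma>"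
    and root: "\<And>p. p \<in> W \<Longrightarrow> \<sigma> p * \<sigma> p = F p * F p - E p * G p"
    and nz: "\<And>p. p \<in> W \<Longrightarrow> \<sigma> p \<noteq> 0" "\<And>p. p \<in> W \<Longrightarrow> \<sigma> p - F p \<noteq> 0"
  obtains f1 f2 where "pseudo_orthonormal_frame X W f1 f2"
    and "\<And>p. p \<in> W \<Longrightarrow> f1 p $ 1 * f2 p $ 2 - f1 p $ 2 * f2 p $ 1 = 1 / \<sigma> p"
proof -
  let ?r = "\<lambda>p. \<sigma> p + - F p"
  let ?c = "\<lambda>p. inverse (2 * (?r p * (\<sigma> p * \<sigma> p)))"
  define f1 :: "real^2 \<Rightarrow> real^2" where "f1 p = ?r p *\<^sub>R axis 1 1 + E p *\<^sub>R axis 2 1" for p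
  define f2 :: "real^2 \<Rightarrow> real^2" where "f2 p = ?c p *\<^sub>R (G p *\<^sub>R axis 1 1 + ?r p *\<^sub>R axis 2 1)" for p
  have EFG: "smooth_on W E" "smooth_on W F" "smooth_on W G"
    unfolding E_def F_def G_def by (intro smooth_on_first_form W X)+
  note sm = W EFG \<sigma> smooth_on_const smooth_on_add smooth_on_minus smooth_on_mult smooth_on_inverse
    smooth_on_bilinear[OF bounded_bilinear_scaleR]
  have sm1: "smooth_on W f1" unfolding f1_def by (intro sm)
  have sm2: "smooth_on W f2" unfolding f2_def using nz by (intro sm) auto
  have comp: "f1 p $ 1 = \<sigma> p - F p" "f1 p $ 2 = E p" "f2 p $ 1 = ?c p * G p" "f2 p $ 2 = ?c p * (\<sigma> p - F p)"
    for p by (simp_all add: f1_def f2_def axis_def)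
  have form: "first_form X p v w = E p * (v$1 * w$1) + F p * (v$1 * w$2 + v$2 * w$1) + G p * (v$2 * w$2)"
    if "p \<in> W" for p v w
    using first_form_coordinates[OF X that, of v w] by (simp add: E_def F_def G_def)
  have frame: "first_form X p (f1 p) (f1 p) = 0 \<and> first_form X p (f2 p) (f2 p) = 0 \<and>
      first_form X p (f1 p) (f2 p) = -1" if p: "p \<in> W" for p
  proof (intro conjI)
    define r where "r = \<sigma> p - F p"
    define c where "c = ?c p"
    have s: "\<sigma> p = r + F p" by (simp add: r_def)
    have EG: "E p * G p = - (r * (r + 2 * F p))" using root[OF p] by (simp add: s algebra_simps)
    have c: "2 * c * (r * (\<sigma> p * \<sigma> p)) = 1" using nz[OF p] by (simp add: c_def r_def field_simps)
    have comp': "f2 p $ 1 = c * G p" "f2 p $ 2 = c * r" "f1 p $ 1 = r" "f1 p $ 2 = E p"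
      by (simp_all only: comp c_def r_def)
    have "first_form X p (f1 p) (f1 p) = E p * (r * (r + 2 * F p) + E p * G p)"
      by (simp add: form[OF p] comp' s algebra_simps)
    then show "first_form X p (f1 p) (f1 p) = 0" by (simp add: EG)
    have "first_form X p (f2 p) (f2 p) = c * c * G p * (r * (r + 2 * F p) + E p * G p)"
      by (simp add: form[OF p] comp' algebra_simps)
    then show "first_form X p (f2 p) (f2 p) = 0" by (simp add: EG)
    have "first_form X p (f1 p) (f2 p) = c * (2 * r * (E p * G p) + F p * (r * r + E p * G p))"
      by (simp add: form[OF p] comp' algebra_simps)
    also have "\<dots> = - (2 * c * (r * (\<sigma> p * \<sigma> p)))" unfolding EG s by (simp add: algebra_simps)
    finally show "first_form X p (f1 p) (f2 p) = -1" using c by simp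
  qed
  have "f1 p $ 1 * f2 p $ 2 - f1 p $ 2 * f2 p $ 1 = 1 / \<sigma> p" if p: "p \<in> W" for p
  proof -
    define r where "r = \<sigma> p - F p"
    have s: "F p = \<sigma> p - r" by (simp add: r_def)
    have EG: "r * r - E p * G p = 2 * (r * \<sigma> p)"
      using root[OF p] by (simp add: s algebra_simps)
    have "f1 p $ 1 * f2 p $ 2 - f1 p $ 2 * f2 p $ 1 = ?c p * (r * r - E p * G p)"
      by (simp add: comp r_def[symmetric] algebra_simps)
    also have "\<dots> = 1 / \<sigma> p" unfolding EG using nz[OF p] by (simp add: r_def field_simps)
    finally show ?thesis .
  qed
  with that[of f1 f2] show ?thesis
    using W sm1 sm2 frame by (simp add: pseudo_orthonormal_frame_def)
qed

text \<open>The preceding construction needs \<open>\<sigma> \<noteq> F\<close>. The two square roots of \<open>F\<^sup>2 - E G > 0\<close> are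
  different, so one of them is admissible near a given point; if it is the negative one, exchanging
  \<open>f\<^sub>1\<close> and \<open>f\<^sub>2\<close> restores the orientation.\<close>

lemma oriented_frame_exists:
  fixes X :: "real^2 \<Rightarrow> real^4"
  assumes U: "open U" and X: "smooth_on U X" and u: "u \<in> U"
    and lor: "\<And>p. p \<in> U \<Longrightarrow> nondegenerate (first_form X p) \<and> form_index (first_form X p) = 1"
  obtains W f1 f2 where "u \<in> W" "W \<subseteq> U" "pseudo_orthonormal_frame X W f1 f2" "positively_oriented W f1 f2"
proof -
  define E where "E = (\<lambda>p. first_form X p (axis 1 1) (axis 1 1))"
  define F where "F = (\<lambda>p. first_form X p (axis 1 1) (axis 2 1))"
  define G where "G = (\<lambda>p. first_form X p (axis 2 1) (axis 2 1))"
  define \<delta> where "\<delta> = (\<lambda>p. F p * F p + - (E p * G p))"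
  have EFG: "smooth_on U E" "smooth_on U F" "smooth_on U G"
    unfolding E_def F_def G_def by (intro smooth_on_first_form U X)+
  have pos: "\<delta> p > 0" if "p \<in> U" for p
    using gram_determinant_negative[OF first_form_coordinates[OF X that]] lor[OF that]
    by (simp add: \<delta>_def E_def F_def G_def)
  have "smooth_on U \<delta>" unfolding \<delta>_def by (intro U smooth_on_add smooth_on_minus smooth_on_mult EFG)
  then have s: "smooth_on U (\<lambda>p. sqrt (\<delta> p))" using pos by (rule smooth_on_sqrt[OF U])
  have open_W: "open {p \<in> U. \<sigma> p - F p \<noteq> 0}" if "smooth_on U \<sigma>" for \<sigma> :: "real^2 \<Rightarrow> real"
  proof -
    have "continuous_on U (\<lambda>p. \<sigma> p - F p)"
      using that EFG by (intro continuous_on_diff smooth_on_imp_continuous_on)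
    then have "open (U \<inter> (\<lambda>p. \<sigma> p - F p) -` (- {0}))"
      using continuous_on_open_vimage[OF U] by (metis Int_commute closed_singleton open_Compl)
    moreover have "U \<inter> (\<lambda>p. \<sigma> p - F p) -` (- {0}) = {p \<in> U. \<sigma> p - F p \<noteq> 0}" by auto
    ultimately show ?thesis by simp
  qed
  show ?thesis
  proof (cases "sqrt (\<delta> u) - F u = 0")
    case False
    let ?W = "{p \<in> U. sqrt (\<delta> p) - F p \<noteq> 0}"
    have sub: "?W \<subseteq> U" by auto
    obtain f1 f2 where f: "pseudo_orthonormal_frame X ?W f1 f2"
      "\<And>p. p \<in> ?W \<Longrightarrow> f1 p $ 1 * f2 p $ 2 - f1 p $ 2 * f2 p $ 1 = 1 / sqrt (\<delta> p)"
      by (rule null_frame_of_square_root[OF open_W[OF s] smooth_on_subset[OF X sub] smooth_on_subset[OF s sub]])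
        (use pos in \<open>force simp: \<delta>_def E_def F_def G_def less_imp_le\<close>)+
    show ?thesis
      by (rule that[OF _ sub f(1)]) (use u False f(2) pos in \<open>auto simp: positively_oriented_def\<close>)
  next
    case True
    let ?W = "{p \<in> U. - sqrt (\<delta> p) - F p \<noteq> 0}"
    have sub: "?W \<subseteq> U" by auto
    have s': "smooth_on U (\<lambda>p. - sqrt (\<delta> p))" by (rule smooth_on_minus[OF U s])
    obtain f1 f2 where f: "pseudo_orthonormal_frame X ?W f1 f2"
      "\<And>p. p \<in> ?W \<Longrightarrow> f1 p $ 1 * f2 p $ 2 - f1 p $ 2 * f2 p $ 1 = 1 / - sqrt (\<delta> p)"
      by (rule null_frame_of_square_root[OF open_W[OF s'] smooth_on_subset[OF X sub] smooth_on_subset[OF s' sub]])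
        (use pos in \<open>force simp: \<delta>_def E_def F_def G_def less_imp_le\<close>)+
    have swapped: "pseudo_orthonormal_frame X ?W f2 f1"
      using f(1) mink_commute by (auto simp: pseudo_orthonormal_frame_def first_form_def)
    have "f2 p $ 1 * f1 p $ 2 - f2 p $ 2 * f1 p $ 1 > 0" if "p \<in> ?W" for p
    proof -
      have "f2 p $ 1 * f1 p $ 2 - f2 p $ 2 * f1 p $ 1 = 1 / sqrt (\<delta> p)"
        using f(2)[OF that] by (simp add: algebra_simps)
      then show ?thesis using that pos[of p] by simp
    qed
    moreover have "u \<in> ?W" using u True pos[OF u] by auto
    ultimately show ?thesis using that[OF _ sub swapped] by (simp add: positively_oriented_def)
  qed
qed

section \<open>Bivectors as complex vectors\<close>

lemma exhaust_6: "(x::6) = 1 \<or> x = 2 \<or> x = 3 \<or> x = 4 \<or> x = 5 \<or> x = 6"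
proof (induct x)
  case (of_int z)
  then have "z = 0 \<or> z = 1 \<or> z = 2 \<or> z = 3 \<or> z = 4 \<or> z = 5" by auto
  then show ?case by auto
qed

lemma forall_6: "(\<forall>i::6. P i) \<longleftrightarrow> P 1 \<and> P 2 \<and> P 3 \<and> P 4 \<and> P 5 \<and> P 6"
  by (metis exhaust_6)

lemma vector_6:
  "(vector [a, b, c, d, e, f] :: real^6) $ 1 = a"
  "(vector [a, b, c, d, e, f] :: real^6) $ 2 = b"
  "(vector [a, b, c, d, e, f] :: real^6) $ 3 = c"
  "(vector [a, b, c, d, e, f] :: real^6) $ 4 = d"
  "(vector [a, b, c, d, e, f] :: real^6) $ 5 = e"
  "(vector [a, b, c, d, e, f] :: real^6) $ 6 = f"
  unfolding vector_def by simp_all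

lemmas wedge_nth = wedge_def vector_6

lemma bounded_bilinear_wedge: "bounded_bilinear wedge"
  unfolding bilinear_conv_bounded_bilinear[symmetric] bilinear_def
  by (auto intro!: linearI simp: vec_eq_iff forall_6 wedge_nth algebra_simps)

text \<open>For the electric and magnetic parts \<open>E = (w\<^sub>1\<^sub>2, w\<^sub>1\<^sub>3, w\<^sub>1\<^sub>4)\<close> and \<open>B = (w\<^sub>3\<^sub>4, - w\<^sub>2\<^sub>4, w\<^sub>2\<^sub>3)\<close> of a
  bivector \<open>w\<close>, these are the components of the complex vector \<open>E + \<i> B\<close>. It is the self-dual part of
  \<open>w\<close> for one of the two orientations, and this correspondence identifies the Lie algebra of the Lorentz group with the complexified
  rotation algebra.\<close>

definition complex_part :: "3 \<Rightarrow> real^6 \<Rightarrow> complex" where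
  "complex_part i w = (if i = 1 then Complex (w$1) (w$6)
     else if i = 2 then Complex (w$2) (- w$5) else Complex (w$3) (w$4))"

lemma complex_part_simps:
  "complex_part 1 w = Complex (w$1) (w$6)"
  "complex_part 2 w = Complex (w$2) (- w$5)"
  "complex_part 3 w = Complex (w$3) (w$4)"
  by (simp_all add: complex_part_def)

lemma bounded_linear_complex_part: "bounded_linear (complex_part i)"
  unfolding linear_conv_bounded_linear[symmetric]
  by (rule linearI) (simp_all add: complex_part_def complex_eq_iff)

lemmas complex_part_linear =
  linear_0[OF bounded_linear.linear[OF bounded_linear_complex_part]]
  linear_add[OF bounded_linear.linear[OF bounded_linear_complex_part]]
  linear_scale[OF bounded_linear.linear[OF bounded_linear_complex_part]]

lemma complex_part_injective:
  assumes "\<And>i. complex_part i v = complex_part i w"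
  shows "v = w"
  using assms[of 1] assms[of 2] assms[of 3]
  by (simp add: complex_part_simps vec_eq_iff forall_6)

text \<open>The real part \<open>E\<^sup>2 - B\<^sup>2\<close> of the complex square is minus the Gram determinant of \<open>a, b\<close>; the
  imaginary part \<open>2 E \<cdot> B\<close> is the Pfaffian, which vanishes for decomposable bivectors. In particular the
  square is zero when \<open>a\<close> is null and orthogonal to \<open>b\<close>.\<close>

lemma complex_part_wedge_square:
  "(\<Sum>i\<in>UNIV. complex_part i (wedge a b) * complex_part i (wedge a b))
   = of_real (mink a b * mink a b - mink a a * mink b b)"
  by (simp add: sum_3 complex_part_simps wedge_nth complex_eq_iff mink_def algebra_simps)

text \<open>Up to the factor \<open>\<i>\<close>, the complex cross product is the commutator of bivectors regarded as
  infinitesimal Lorentz transformations, here written out for decomposable bivectors.\<close>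

lemma complex_part_wedge_bracket:
  assumes "(i, j, k) \<in> {(1, 2, 3), (2, 3, 1), (3, 1, 2)}"
  shows "complex_part i (wedge a b) * complex_part j (wedge c d)
    - complex_part j (wedge a b) * complex_part i (wedge c d)
    = \<i> * (mink a c *\<^sub>R complex_part k (wedge b d) - mink a d *\<^sub>R complex_part k (wedge b c)
      - mink b c *\<^sub>R complex_part k (wedge a d) + mink b d *\<^sub>R complex_part k (wedge a c))"
  using assms
  by (auto simp: complex_part_simps wedge_nth complex_eq_iff mink_def algebra_simps)

text \<open>Bivectors of orthogonal planes commute, so the cross product of their complex forms is zero. This
  makes normal bivectors complex multiples of the tangent bivector.\<close>

lemma orthogonal_wedges_parallel:
  assumes "mink a c = 0" "mink a d = 0" "mink b c = 0" "mink b d = 0"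
  shows "complex_part i (wedge a b) * complex_part j (wedge c d)
    = complex_part j (wedge a b) * complex_part i (wedge c d)"
  using complex_part_wedge_bracket[of 1 2 3 a b c d] complex_part_wedge_bracket[of 2 3 1 a b c d]
    complex_part_wedge_bracket[of 3 1 2 a b c d] assms exhaust_3[of i] exhaust_3[of j]
  by auto

section \<open>Minimal surfaces in a pseudo-orthonormal frame\<close>

text \<open>The Christoffel symbols are symmetric in the lower indices because the metric is symmetric. This
  and the minimality condition together determine all covariant derivatives that occur in the
  Laplace operator.\<close>

lemma levi_civita_torsion_free:
  "levi_civita X Y Z p - levi_civita X Z Y p = vf_deriv Y Z p - vf_deriv Z Y p"
proof -
  have "metric_matrix X q $ i $ j = metric_matrix X q $ j $ i" for q i j
    by (simp add: metric_matrix_def first_form_def mink_commute)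
  then have sym: "christoffel X p k i j = christoffel X p k j i" for k i j
    unfolding christoffel_def metric_partial_def by (simp add: add.commute)
  have "(\<Sum>i\<in>UNIV. \<Sum>j\<in>UNIV. christoffel X p k i j * (Y p $ i) * (Z p $ j))
      = (\<Sum>i\<in>UNIV. \<Sum>j\<in>UNIV. christoffel X p k i j * (Z p $ i) * (Y p $ j))" for k
    using sym[of k 1 2] by (simp add: sum_2)
  then show ?thesis by (simp add: levi_civita_def)
qed

lemma plane_basis_expansion:
  fixes v w z :: "real^2"
  assumes "v$1 * w$2 - v$2 * w$1 > 0"
  obtains s t where "z = s *\<^sub>R v + t *\<^sub>R w"
proof
  let ?d = "v$1 * w$2 - v$2 * w$1"
  have "z$1 * ?d = (z$1 * w$2 - z$2 * w$1) * v$1 + (v$1 * z$2 - v$2 * z$1) * w$1"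
    and "z$2 * ?d = (z$1 * w$2 - z$2 * w$1) * v$2 + (v$1 * z$2 - v$2 * z$1) * w$2"
    by (simp_all add: algebra_simps)
  then show "z = ((z$1 * w$2 - z$2 * w$1) / ?d) *\<^sub>R v + ((v$1 * z$2 - v$2 * z$1) / ?d) *\<^sub>R w"
    using assms by (simp add: vec_eq_iff forall_2 add_divide_distrib[symmetric] eq_divide_eq)
qed

interpretation mink: bounded_bilinear mink by (rule bounded_bilinear_mink)
interpretation wedge: bounded_bilinear wedge by (rule bounded_bilinear_wedge)

locale minimal_frame =
  fixes X :: "real^2 \<Rightarrow> real^4" and W :: "(real^2) set" and f1 f2 :: "real^2 \<Rightarrow> real^2"
  assumes X: "smooth_on W X"
    and frame: "pseudo_orthonormal_frame X W f1 f2"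
    and oriented: "positively_oriented W f1 f2"
    and minimal: "p \<in> W \<Longrightarrow> mean_curvature X f1 f2 p = 0"
begin

abbreviation "D1 \<equiv> vf_deriv f1"
abbreviation "D2 \<equiv> vf_deriv f2"

definition "e1 = D1 X"
definition "e2 = D2 X"

lemma W: "open W" and f1: "smooth_on W f1" and f2: "smooth_on W f2"
  using frame by (simp_all add: pseudo_orthonormal_frame_def)

lemma e1: "smooth_on W e1" and e2: "smooth_on W e2"
  unfolding e1_def e2_def by (intro smooth_on_vf_deriv W f1 f2 X)+

lemma null_frame:
  assumes "p \<in> W"
  shows "mink (e1 p) (e1 p) = 0" "mink (e2 p) (e2 p) = 0" "mink (e1 p) (e2 p) = -1" "mink (e2 p) (e1 p) = -1"
  using frame assms mink_commute[of "e2 p" "e1 p"]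
  by (simp_all add: pseudo_orthonormal_frame_def first_form_def e1_def e2_def vf_deriv_def)

lemma mink_vf_deriv:
  assumes u: "smooth_on W u" and v: "smooth_on W v" and c: "\<And>q. q \<in> W \<Longrightarrow> mink (u q) (v q) = c" and p: "p \<in> W"
  shows "mink (u p) (vf_deriv Y v p) + mink (vf_deriv Y u p) (v p) = 0"
proof -
  have "vf_deriv Y (\<lambda>q. mink (u q) (v q)) p = vf_deriv Y (\<lambda>q. c) p"
    by (rule vf_deriv_cong[OF W smooth_on_bilinear[OF bounded_bilinear_mink W u v] c p])
  then show ?thesis by (simp add: vf_deriv_bilinear[OF bounded_bilinear_mink u v p] vf_deriv_const)
qed

text \<open>Coefficients of the Levi-Civita connection: \<open>\<nabla>\<^bsub>f\<^sub>2\<^esub> f\<^sub>1 = a f\<^sub>1\<close> and \<open>\<nabla>\<^bsub>f\<^sub>1\<^esub> f\<^sub>2 = b f\<^sub>2\<close>. They are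
  defined through inner products to make their smoothness evident.\<close>

definition "a p = - mink (D2 e1 p) (e2 p)"
definition "b p = - mink (D1 e2 p) (e1 p)"

lemma a: "smooth_on W a" and b: "smooth_on W b"
  unfolding a_def b_def
  by (intro smooth_on_minus smooth_on_bilinear[OF bounded_bilinear_mink] smooth_on_vf_deriv W f1 f2 e1 e2)+

lemma push_forward:
  assumes "p \<in> W"
  shows "frechet_derivative X (at p) (s *\<^sub>R f1 p + t *\<^sub>R f2 p) = s *\<^sub>R e1 p + t *\<^sub>R e2 p"
  using has_derivative_linear[OF smooth_on_has_derivative[OF X assms]]
  by (simp add: linear_add linear_scale e1_def e2_def vf_deriv_def)

text \<open>Minimality makes \<open>D\<^sub>1 e\<^sub>2\<close> tangent, equal to the image of \<open>\<nabla>\<^bsub>f\<^sub>1\<^esub> f\<^sub>2\<close>. It is orthogonal to the null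
  vector \<open>e\<^sub>2\<close> of the tangent plane and therefore a multiple of it.\<close>

lemma levi_civita_f1_f2:
  assumes p: "p \<in> W"
  shows "levi_civita X f1 f2 p = b p *\<^sub>R f2 p" and D1_e2: "D1 e2 p = b p *\<^sub>R e2 p"
proof -
  obtain s t where st: "levi_civita X f1 f2 p = s *\<^sub>R f1 p + t *\<^sub>R f2 p"
    using plane_basis_expansion oriented p unfolding positively_oriented_def by blast
  have e2_eq: "e2 = (\<lambda>q. frechet_derivative X (at q) (f2 q))"
    by (simp add: e2_def vf_deriv_def[abs_def])
  have "D1 e2 p = frechet_derivative X (at p) (levi_civita X f1 f2 p)"
    using minimal[OF p] by (simp add: mean_curvature_def second_form_def e2_eq)
  then have D: "D1 e2 p = s *\<^sub>R e1 p + t *\<^sub>R e2 p" by (simp add: st push_forward[OF p])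
  have "mink (D1 e2 p) (e2 p) = 0"
    using mink_vf_deriv[OF e2 e2 null_frame(2) p, of f1]
    by (simp add: mink_commute)
  then have s: "s = 0" using null_frame[OF p] by (simp add: D mink.add_left mink.scaleR_left)
  have "b p = t" using null_frame[OF p] by (simp add: b_def D mink.add_left mink.scaleR_left)
  with s st D show "levi_civita X f1 f2 p = b p *\<^sub>R f2 p" "D1 e2 p = b p *\<^sub>R e2 p" by auto
qed

text \<open>The second fundamental form is symmetric, since the second derivatives of \<open>X\<close> commute up to the
  bracket of \<open>f\<^sub>1, f\<^sub>2\<close>, which is the difference of the covariant derivatives. So \<open>D\<^sub>2 e\<^sub>1\<close> is tangent as
  well.\<close>

lemma levi_civita_f2_f1:
  assumes p: "p \<in> W"
  shows "levi_civita X f2 f1 p = a p *\<^sub>R f1 p" and D2_e1: "D2 e1 p = a p *\<^sub>R e1 p"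
proof -
  obtain s t where st: "levi_civita X f2 f1 p = s *\<^sub>R f1 p + t *\<^sub>R f2 p"
    using plane_basis_expansion oriented p unfolding positively_oriented_def by blast
  have lin: "linear (frechet_derivative X (at p))"
    by (rule has_derivative_linear[OF smooth_on_has_derivative[OF X p]])
  have "D1 e2 p - D2 e1 p = frechet_derivative X (at p) (levi_civita X f1 f2 p - levi_civita X f2 f1 p)"
    using vf_deriv_commutator[OF W X f1 f2 p]
    by (simp add: e1_def e2_def levi_civita_torsion_free linear_diff[OF lin] vf_deriv_def[of "vf_deriv _ _"])
  moreover have "D1 e2 p = frechet_derivative X (at p) (levi_civita X f1 f2 p)"
    using push_forward[OF p, of 0 "b p"] by (simp add: levi_civita_f1_f2(1)[OF p] D1_e2[OF p])
  ultimately have "D1 e2 p - D2 e1 p = D1 e2 p - (s *\<^sub>R e1 p + t *\<^sub>R e2 p)"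
    by (simp only: linear_diff[OF lin] st push_forward[OF p])
  from arg_cong[OF this, of "\<lambda>z. D1 e2 p - z"] have D: "D2 e1 p = s *\<^sub>R e1 p + t *\<^sub>R e2 p"
    by simp
  have "mink (D2 e1 p) (e1 p) = 0"
    using mink_vf_deriv[OF e1 e1 null_frame(1) p, of f2]
    by (simp add: mink_commute)
  then have t: "t = 0" using null_frame[OF p] by (simp add: D mink.add_left mink.scaleR_left)
  have "a p = s" using null_frame[OF p] by (simp add: a_def D mink.add_left mink.scaleR_left)
  with t st D show "levi_civita X f2 f1 p = a p *\<^sub>R f1 p" "D2 e1 p = a p *\<^sub>R e1 p" by auto
qed

lemma commutator:
  fixes g :: "real^2 \<Rightarrow> 'b::euclidean_space"
  assumes g: "smooth_on W g" and p: "p \<in> W"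
  shows "D1 (D2 g) p - D2 (D1 g) p = b p *\<^sub>R D2 g p - a p *\<^sub>R D1 g p"
proof -
  have lin: "linear (frechet_derivative g (at p))"
    by (rule has_derivative_linear[OF smooth_on_has_derivative[OF g p]])
  have "D1 (D2 g) p - D2 (D1 g) p = frechet_derivative g (at p) (vf_deriv f1 f2 p - vf_deriv f2 f1 p)"
    using vf_deriv_commutator[OF W g f1 f2 p]
    by (simp add: linear_diff[OF lin] vf_deriv_def[of "vf_deriv _ _"])
  also have "vf_deriv f1 f2 p - vf_deriv f2 f1 p = b p *\<^sub>R f2 p - a p *\<^sub>R f1 p"
    by (simp add: levi_civita_torsion_free[of X, symmetric] levi_civita_f1_f2(1)[OF p] levi_civita_f2_f1(1)[OF p])
  finally have "D1 (D2 g) p - D2 (D1 g) p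
      = b p *\<^sub>R frechet_derivative g (at p) (f2 p) - a p *\<^sub>R frechet_derivative g (at p) (f1 p)"
    by (simp only: linear_diff[OF lin] linear_scale[OF lin])
  moreover have "frechet_derivative g (at p) (f1 p) = D1 g p" "frechet_derivative g (at p) (f2 p) = D2 g p"
    by (simp_all add: vf_deriv_def)
  ultimately show ?thesis by (simp only:)
qed

text \<open>The bracket of the frame fields accounts for the difference between the two orders of
  differentiation, so that the symmetric expression for the Laplace operator is twice either half.\<close>

lemma laplacian_eq:
  fixes g :: "real^2 \<Rightarrow> 'b::euclidean_space"
  assumes g: "smooth_on W g" and p: "p \<in> W"
  shows "laplacian X f1 f2 g p = 2 *\<^sub>R (D1 (D2 g) p - b p *\<^sub>R D2 g p)"
    and "laplacian X f1 f2 g p = 2 *\<^sub>R (D2 (D1 g) p - a p *\<^sub>R D1 g p)"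
proof -
  have lin: "linear (frechet_derivative g (at p))"
    by (rule has_derivative_linear[OF smooth_on_has_derivative[OF g p]])
  have L: "laplacian X f1 f2 g p = D1 (D2 g) p + D2 (D1 g) p - b p *\<^sub>R D2 g p - a p *\<^sub>R D1 g p"
    by (simp add: laplacian_def vf_deriv_def[of "levi_civita _ _ _"] levi_civita_f1_f2(1)[OF p]
        levi_civita_f2_f1(1)[OF p] linear_scale[OF lin]) (simp add: vf_deriv_def)
  have average: "x + y - u - v = 2 *\<^sub>R (x - u)" if "y - v = x - u" for x y u v :: 'b
  proof -
    have "x + y - u - v = (x - u) + (y - v)" by simp
    then show ?thesis by (simp add: that scaleR_2)
  qed
  from commutator[OF g p] have c: "D2 (D1 g) p - a p *\<^sub>R D1 g p = D1 (D2 g) p - b p *\<^sub>R D2 g p"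
    by (simp add: algebra_simps)
  show "laplacian X f1 f2 g p = 2 *\<^sub>R (D1 (D2 g) p - b p *\<^sub>R D2 g p)"
    unfolding L by (rule average[OF c])
  then show "laplacian X f1 f2 g p = 2 *\<^sub>R (D2 (D1 g) p - a p *\<^sub>R D1 g p)"
    by (simp only: c)
qed

lemma laplacian_cong:
  fixes g :: "real^2 \<Rightarrow> 'b::euclidean_space"
  assumes g: "smooth_on W g" and eq: "\<And>q. q \<in> W \<Longrightarrow> g q = h q" and p: "p \<in> W"
  shows "laplacian X f1 f2 g p = laplacian X f1 f2 h p"
proof -
  have h: "smooth_on W h" by (rule smooth_on_cong[OF W g eq])
  have D: "vf_deriv Y g q = vf_deriv Y h q" if "q \<in> W" for Y q
    by (rule vf_deriv_cong[OF W g eq that])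
  have "D1 (D2 g) p = D1 (D2 h) p"
    by (rule vf_deriv_cong[OF W smooth_on_vf_deriv[OF W f2 g] D p])
  then show ?thesis using D[OF p] by (simp add: laplacian_eq(1)[OF g p] laplacian_eq(1)[OF h p])
qed

lemma laplacian_linear:
  fixes g :: "real^2 \<Rightarrow> 'b::euclidean_space" and L :: "'b \<Rightarrow> 'c::euclidean_space"
  assumes L: "bounded_linear L" and g: "smooth_on W g" and p: "p \<in> W"
  shows "laplacian X f1 f2 (\<lambda>q. L (g q)) p = L (laplacian X f1 f2 g p)"
proof -
  interpret L: bounded_linear L by (rule L)
  have D: "D2 (\<lambda>q. L (g q)) q = L (D2 g q)" if "q \<in> W" for q
    by (rule vf_deriv_linear[OF L g that])
  have "D1 (D2 (\<lambda>q. L (g q))) p = D1 (\<lambda>q. L (D2 g q)) p"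
    by (rule vf_deriv_cong[OF W smooth_on_vf_deriv[OF W f2 smooth_on_linear[OF L W g]] D p])
  also have "\<dots> = L (D1 (D2 g) p)"
    by (rule vf_deriv_linear[OF L smooth_on_vf_deriv[OF W f2 g] p])
  finally show ?thesis
    by (simp add: laplacian_eq(1)[OF g p] laplacian_eq(1)[OF smooth_on_linear[OF L W g] p] D[OF p]
        L.diff L.scaleR)
qed

lemma laplacian_add:
  fixes g h :: "real^2 \<Rightarrow> 'b::euclidean_space"
  assumes g: "smooth_on W g" and h: "smooth_on W h" and p: "p \<in> W"
  shows "laplacian X f1 f2 (\<lambda>q. g q + h q) p = laplacian X f1 f2 g p + laplacian X f1 f2 h p"
proof -
  have D: "D2 (\<lambda>q. g q + h q) q = D2 g q + D2 h q" if "q \<in> W" for q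
    by (rule vf_deriv_add[OF g h that])
  have "D1 (D2 (\<lambda>q. g q + h q)) p = D1 (\<lambda>q. D2 g q + D2 h q) p"
    by (rule vf_deriv_cong[OF W smooth_on_vf_deriv[OF W f2 smooth_on_add[OF W g h]] D p])
  also have "\<dots> = D1 (D2 g) p + D1 (D2 h) p"
    by (rule vf_deriv_add[OF smooth_on_vf_deriv[OF W f2 g] smooth_on_vf_deriv[OF W f2 h] p])
  finally show ?thesis
    by (simp add: laplacian_eq(1)[OF g p] laplacian_eq(1)[OF h p] laplacian_eq(1)[OF smooth_on_add[OF W g h] p]
        D[OF p] algebra_simps)
qed

text \<open>The values \<open>h(f\<^sub>1, f\<^sub>1)\<close> and \<open>h(f\<^sub>2, f\<^sub>2)\<close> of the second fundamental form.\<close>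

definition "h p = D1 e1 p + b p *\<^sub>R e1 p"
definition "k p = D2 e2 p + a p *\<^sub>R e2 p"

lemma h: "smooth_on W h"
  unfolding h_def
  by (intro smooth_on_add smooth_on_bilinear[OF bounded_bilinear_scaleR] smooth_on_vf_deriv W f1 e1 b)

lemma normal:
  assumes p: "p \<in> W"
  shows "mink (h p) (e1 p) = 0" "mink (h p) (e2 p) = 0" "mink (k p) (e1 p) = 0" "mink (k p) (e2 p) = 0"
proof -
  have "mink (D1 e1 p) (e1 p) = 0" "mink (D2 e2 p) (e2 p) = 0"
    using mink_vf_deriv[OF e1 e1 null_frame(1) p, of f1] mink_vf_deriv[OF e2 e2 null_frame(2) p, of f2]
    by (simp_all add: mink_commute)
  moreover have "mink (D1 e1 p) (e2 p) = b p" "mink (D2 e2 p) (e1 p) = a p"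
    using mink_vf_deriv[OF e1 e2 null_frame(3) p, of f1] mink_vf_deriv[OF e2 e1 null_frame(4) p, of f2]
    by (simp_all add: D1_e2[OF p] D2_e1[OF p] mink.scaleR_right null_frame[OF p])
  ultimately show "mink (h p) (e1 p) = 0" "mink (h p) (e2 p) = 0" "mink (k p) (e1 p) = 0" "mink (k p) (e2 p) = 0"
    by (simp_all add: h_def k_def mink.add_left mink.scaleR_left null_frame[OF p])
qed

definition "\<nu> p = wedge (e1 p) (e2 p)"

lemma \<nu>: "smooth_on W \<nu>"
  unfolding \<nu>_def by (intro smooth_on_bilinear[OF bounded_bilinear_wedge] W e1 e2)

lemma D1_\<nu>:
  assumes p: "p \<in> W"
  shows "D1 \<nu> p = wedge (h p) (e2 p)"
  unfolding \<nu>_def[abs_def] vf_deriv_bilinear[OF bounded_bilinear_wedge e1 e2 p] D1_e2[OF p] h_def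
  by (simp add: wedge.add_left wedge.scaleR_left wedge.scaleR_right)

lemma D2_\<nu>:
  assumes p: "p \<in> W"
  shows "D2 \<nu> p = wedge (e1 p) (k p)"
  unfolding \<nu>_def[abs_def] vf_deriv_bilinear[OF bounded_bilinear_wedge e1 e2 p] D2_e1[OF p] k_def
  by (simp add: wedge.add_right wedge.scaleR_left wedge.scaleR_right)

text \<open>A form of the Codazzi equation: the derivative of \<open>h\<close> is found by commuting the two
  differentiations of \<open>e\<^sub>1\<close>, because \<open>D\<^sub>2 e\<^sub>1\<close> is already known.\<close>

lemma D2_h:
  assumes p: "p \<in> W"
  shows "D2 h p = (2 * a p) *\<^sub>R D1 e1 p + (D1 a p + D2 b p) *\<^sub>R e1 p"
proof -
  have "D1 (D2 e1) p = D1 (\<lambda>q. a q *\<^sub>R e1 q) p"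
    by (rule vf_deriv_cong[OF W smooth_on_vf_deriv[OF W f2 e1] D2_e1 p])
  also have "\<dots> = a p *\<^sub>R D1 e1 p + D1 a p *\<^sub>R e1 p"
    by (rule vf_deriv_bilinear[OF bounded_bilinear_scaleR a e1 p])
  finally have D12: "D1 (D2 e1) p = a p *\<^sub>R D1 e1 p + D1 a p *\<^sub>R e1 p" .
  have Dh: "D2 h p = D2 (D1 e1) p + (b p *\<^sub>R D2 e1 p + D2 b p *\<^sub>R e1 p)"
    unfolding h_def[abs_def]
    by (simp add: vf_deriv_add[OF smooth_on_vf_deriv[OF W f1 e1]
          smooth_on_bilinear[OF bounded_bilinear_scaleR W b e1] p]
        vf_deriv_bilinear[OF bounded_bilinear_scaleR b e1 p])
  show ?thesis
  proof (intro vec_eq_iff[THEN iffD2] allI)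
    fix i
    note component = arg_cong[of _ _ "\<lambda>v. v $ i"]
    show "D2 h p $ i = ((2 * a p) *\<^sub>R D1 e1 p + (D1 a p + D2 b p) *\<^sub>R e1 p) $ i"
      using component[OF D12] component[OF Dh] component[OF commutator[OF e1 p]]
      by (simp add: algebra_simps)
  qed
qed

lemma laplacian_\<nu>:
  assumes p: "p \<in> W"
  shows "laplacian X f1 f2 \<nu> p
    = 2 *\<^sub>R ((D1 a p + D2 b p - 2 * a p * b p) *\<^sub>R \<nu> p + wedge (h p) (k p))"
proof -
  define \<kappa> where "\<kappa> = D1 a p + D2 b p - 2 * a p * b p"
  have "D2 (D1 \<nu>) p = D2 (\<lambda>q. wedge (h q) (e2 q)) p"
    by (rule vf_deriv_cong[OF W smooth_on_vf_deriv[OF W f1 \<nu>] D1_\<nu> p])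
  also have "\<dots> = wedge (h p) (D2 e2 p) + wedge (D2 h p) (e2 p)"
    by (rule vf_deriv_bilinear[OF bounded_bilinear_wedge h e2 p])
  also have "D2 e2 p = k p - a p *\<^sub>R e2 p" by (simp add: k_def)
  also have "D2 h p = (2 * a p) *\<^sub>R h p + \<kappa> *\<^sub>R e1 p"
    unfolding D2_h[OF p] h_def \<kappa>_def by (intro vec_eq_iff[THEN iffD2] allI) (simp add: algebra_simps)
  finally have "D2 (D1 \<nu>) p = wedge (h p) (k p) - a p *\<^sub>R D1 \<nu> p
      + ((2 * a p) *\<^sub>R D1 \<nu> p + \<kappa> *\<^sub>R \<nu> p)"
    by (simp add: D1_\<nu>[OF p] \<nu>_def[of p] wedge.add_left wedge.diff_right wedge.scaleR_left wedge.scaleR_right)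
  then have "D2 (D1 \<nu>) p - a p *\<^sub>R D1 \<nu> p = \<kappa> *\<^sub>R \<nu> p + wedge (h p) (k p)"
    by (simp add: vec_eq_iff)
  then show ?thesis by (simp add: laplacian_eq(2)[OF \<nu> p] \<kappa>_def)
qed

lemma laplacian_\<nu>_parallel:
  assumes p: "p \<in> W"
  shows "complex_part i (laplacian X f1 f2 \<nu> p) * complex_part j (\<nu> p)
       = complex_part j (laplacian X f1 f2 \<nu> p) * complex_part i (\<nu> p)"
proof -
  have parallel: "complex_part i (wedge (h p) (k p)) * complex_part j (\<nu> p)
      = complex_part j (wedge (h p) (k p)) * complex_part i (\<nu> p)"
    unfolding \<nu>_def by (intro orthogonal_wedges_parallel normal[OF p])
  then show ?thesis
    unfolding laplacian_\<nu>[OF p] complex_part_linear scaleR_conv_of_real[where 'a = complex]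
    by (simp add: algebra_simps)
qed

lemma \<nu>_nonzero: "p \<in> W \<Longrightarrow> \<nu> p \<noteq> 0"
  using complex_part_wedge_square[of "e1 p" "e2 p"] null_frame[of p]
  by (auto simp: \<nu>_def complex_part_linear)

text \<open>The function \<open>\<phi>\<close> is recovered as the product \<open>N \<cdot> \<Delta> N\<close>, which shows that it is smooth; the
  parallelism of \<open>\<Delta> \<nu> = \<mu> A\<close> and \<open>\<nu>\<close> gives \<open>\<Delta> N = \<phi> N\<close>. The two values of \<open>\<phi>\<close> mean that \<open>A\<close> is zero or
  that it is equal to \<open>\<nu>\<close>.\<close>

lemma eigenvector_dichotomy:
  fixes A B :: "real^2 \<Rightarrow> real^6" and c :: "real^6" and \<mu> :: real
  assumes A: "smooth_on W A" and B: "smooth_on W B"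
    and decomp: "\<And>q. q \<in> W \<Longrightarrow> \<nu> q = c + A q + B q"
    and LA: "\<And>q. q \<in> W \<Longrightarrow> laplacian X f1 f2 A q = \<mu> *\<^sub>R A q"
    and LB: "\<And>q. q \<in> W \<Longrightarrow> laplacian X f1 f2 B q = 0"
    and "\<mu> \<noteq> 0" and p: "p \<in> W"
  shows "A p = 0 \<or> c + B p = 0"
proof -
  have L\<nu>: "laplacian X f1 f2 \<nu> q = \<mu> *\<^sub>R A q" if q: "q \<in> W" for q
  proof -
    have "laplacian X f1 f2 \<nu> q = laplacian X f1 f2 (\<lambda>q. c + A q + B q) q"
      by (rule laplacian_cong[OF \<nu> decomp q])
    also have "\<dots> = laplacian X f1 f2 (\<lambda>q. c) q + laplacian X f1 f2 A q + laplacian X f1 f2 B q"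
      by (simp add: laplacian_add[OF smooth_on_add[OF W smooth_on_const A] B q]
          laplacian_add[OF smooth_on_const A q])
    also have "laplacian X f1 f2 (\<lambda>q. c) q = 0"
      by (simp add: laplacian_def vf_deriv_def[abs_def])
    finally show ?thesis by (simp add: LA[OF q] LB[OF q])
  qed
  define N where "N = (\<lambda>i q. complex_part i (\<nu> q))"
  define \<phi> where "\<phi> = (\<lambda>q. \<Sum>i\<in>UNIV. complex_part i (\<mu> *\<^sub>R A q) * N i q)"
  have N: "smooth_on W (N i)" for i
    unfolding N_def by (rule smooth_on_linear[OF bounded_linear_complex_part W \<nu>])
  have A': "smooth_on W (\<lambda>q. complex_part i (\<mu> *\<^sub>R A q))" for i
    by (intro smooth_on_linear[OF bounded_linear_complex_part W] smooth_on_linear[OF bounded_linear_scaleR_right W A])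
  have \<phi>: "smooth_on W \<phi>" unfolding \<phi>_def by (intro smooth_on_sum W smooth_on_mult A' N)
  have unit: "(\<Sum>i\<in>UNIV. N i q * N i q) = 1" if q: "q \<in> W" for q
    using null_frame[OF q] complex_part_wedge_square[of "e1 q" "e2 q"] by (simp add: N_def \<nu>_def)
  have AN: "complex_part i (\<mu> *\<^sub>R A q) = \<phi> q * N i q" if q: "q \<in> W" for i q
  proof -
    have "complex_part i (\<mu> *\<^sub>R A q) = (\<Sum>j\<in>UNIV. complex_part i (\<mu> *\<^sub>R A q) * N j q * N j q)"
      using unit[OF q] by (simp add: mult.assoc sum_distrib_left[symmetric])
    also have "\<dots> = (\<Sum>j\<in>UNIV. complex_part j (\<mu> *\<^sub>R A q) * N j q * N i q)"
    proof (rule sum.cong[OF refl])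
      fix j
      have "complex_part i (\<mu> *\<^sub>R A q) * N j q = complex_part j (\<mu> *\<^sub>R A q) * N i q"
        using laplacian_\<nu>_parallel[OF q, of i j] by (simp only: L\<nu>[OF q] N_def)
      then show "complex_part i (\<mu> *\<^sub>R A q) * N j q * N j q = complex_part j (\<mu> *\<^sub>R A q) * N j q * N i q"
        by (simp add: ac_simps)
    qed
    also have "\<dots> = \<phi> q * N i q" by (simp add: \<phi>_def sum_distrib_right)
    finally show ?thesis .
  qed
  have "\<phi> p = 0 \<or> \<phi> p = of_real \<mu>"
  proof (rule null_gauss_map_dichotomy[OF W f1 f2 N \<phi> _ _ unit _ _ _ _ p,
        where L = "laplacian X f1 f2" and a = "\<lambda>q. of_real (a q)" and b = "\<lambda>q. of_real (b q)"])
    fix g :: "real^2 \<Rightarrow> complex" and q assume g: "smooth_on W g" and q: "q \<in> W"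
    show "laplacian X f1 f2 g q = 2 * (D1 (D2 g) q - of_real (b q) * D2 g q)"
      using laplacian_eq(1)[OF g q] by (simp add: scaleR_conv_of_real)
    show "laplacian X f1 f2 g q = 2 * (D2 (D1 g) q - of_real (a q) * D1 g q)"
      using laplacian_eq(2)[OF g q] by (simp add: scaleR_conv_of_real)
  next
    fix q assume q: "q \<in> W"
    have D: "vf_deriv Y (N i) q = complex_part i (vf_deriv Y \<nu> q)" for Y i
      unfolding N_def by (rule vf_deriv_linear[OF bounded_linear_complex_part \<nu> q])
    show "(\<Sum>i\<in>UNIV. D1 (N i) q * D1 (N i) q) = 0"
      by (simp add: D D1_\<nu>[OF q] complex_part_wedge_square null_frame[OF q] normal[OF q])
    show "(\<Sum>i\<in>UNIV. D2 (N i) q * D2 (N i) q) = 0"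
      using normal(3)[OF q]
      by (simp add: D D2_\<nu>[OF q] complex_part_wedge_square null_frame[OF q] mink_commute)
  next
    fix i q assume q: "q \<in> W"
    have "laplacian X f1 f2 (N i) q = complex_part i (laplacian X f1 f2 \<nu> q)"
      unfolding N_def by (rule laplacian_linear[OF bounded_linear_complex_part \<nu> q])
    then show "laplacian X f1 f2 (N i) q = \<phi> q * N i q" by (simp only: L\<nu>[OF q] AN[OF q])
    have "laplacian X f1 f2 (\<lambda>q. \<phi> q * N i q) q = laplacian X f1 f2 (\<lambda>q. complex_part i (\<mu> *\<^sub>R A q)) q"
      by (rule laplacian_cong[OF smooth_on_mult[OF W \<phi> N] _ q]) (simp add: AN)
    also have "\<dots> = complex_part i (\<mu> *\<^sub>R laplacian X f1 f2 A q)"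
      using laplacian_linear[OF bounded_linear_compose[OF bounded_linear_complex_part
            bounded_linear_scaleR_right] A q, of i \<mu>] by simp
    also have "\<dots> = of_real \<mu> * complex_part i (\<mu> *\<^sub>R A q)"
      by (simp add: LA[OF q] complex_part_linear scaleR_conv_of_real[where 'a = complex])
    finally show "laplacian X f1 f2 (\<lambda>q. \<phi> q * N i q) q = of_real \<mu> * (\<phi> q * N i q)"
      by (simp only: AN[OF q])
  qed
  then show ?thesis
  proof
    assume "\<phi> p = 0"
    then have "complex_part i (\<mu> *\<^sub>R A p) = complex_part i 0" for i
      by (simp only: AN[OF p] complex_part_linear(1) mult_zero_left)
    then have "\<mu> *\<^sub>R A p = 0" by (rule complex_part_injective)
    then show ?thesis using \<open>\<mu> \<noteq> 0\<close> by simp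
  next
    assume "\<phi> p = of_real \<mu>"
    then have "complex_part i (\<mu> *\<^sub>R A p) = complex_part i (\<mu> *\<^sub>R \<nu> p)" for i
      by (simp only: AN[OF p]) (simp add: complex_part_linear N_def scaleR_conv_of_real[where 'a = complex])
    then have "\<mu> *\<^sub>R A p = \<mu> *\<^sub>R \<nu> p" by (rule complex_part_injective)
    then show ?thesis using \<open>\<mu> \<noteq> 0\<close> decomp[OF p] by simp
  qed
qed

end

section \<open>The global argument\<close>

lemma openin_smooth_map_neq:
  fixes S :: "'a surface"
  assumes S: "oriented_surface S" and g: "smooth_map S g"
  shows "openin (carrier_top S) {q \<in> topspace (carrier_top S). g q \<noteq> c}"
proof -
  let ?T = "carrier_top S"
  have piece: "openin ?T (x ` {u \<in> U. g (x u) \<noteq> c})" if Ux: "(U, x) \<in> params S" for U x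
  proof -
    have U: "open U" and V: "openin ?T (x ` U)"
      and hom: "homeomorphic_map (top_of_set U) (subtopology ?T (x ` U)) x"
      using S Ux by (auto simp: oriented_surface_def)
    have "continuous_on U (g \<circ> x)"
      using g Ux unfolding smooth_map_def by (blast intro: smooth_on_imp_continuous_on)
    then have "open (U \<inter> (g \<circ> x) -` (- {c}))"
      using continuous_on_open_vimage[OF U] by (metis Int_commute closed_singleton open_Compl)
    moreover have "U \<inter> (g \<circ> x) -` (- {c}) = {u \<in> U. g (x u) \<noteq> c}" by auto
    ultimately have "openin (top_of_set U) {u \<in> U. g (x u) \<noteq> c}"
      using U by (simp add: openin_open_eq)
    then have "openin (subtopology ?T (x ` U)) (x ` {u \<in> U. g (x u) \<noteq> c})"
      using homeomorphic_imp_open_map[OF hom] by (simp add: open_map_def)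
    then show ?thesis using V by (rule openin_trans_full)
  qed
  have top: "topspace ?T = (\<Union>(U, x)\<in>params S. x ` U)"
    using S by (simp add: oriented_surface_def)
  have "{q \<in> topspace ?T. g q \<noteq> c} = (\<Union>(U, x)\<in>params S. x ` {u \<in> U. g (x u) \<noteq> c})"
    unfolding top by fastforce
  moreover have "openin ?T (\<Union>(U, x)\<in>params S. x ` {u \<in> U. g (x u) \<noteq> c})"
    by (intro openin_Union) (use piece in auto)
  ultimately show ?thesis by simp
qed

lemma pointwise_dichotomy:
  fixes S :: "'a surface" and A B :: "'a \<Rightarrow> real^6"
  assumes S: "lorentzian_surface S" and min: "minimal_surface S" and gauss: "is_gauss_map S \<nu>"
    and decomp: "\<And>q. q \<in> topspace (carrier_top S) \<Longrightarrow> \<nu> q = c + A q + B q"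
    and A: "laplace_eigenvector S \<mu> A" and B: "laplace_eigenvector S 0 B" and \<mu>: "\<mu> \<noteq> 0"
    and q: "q \<in> topspace (carrier_top S)"
  shows "\<nu> q \<noteq> 0 \<and> (A q = 0 \<or> c + B q = 0)"
proof -
  have top: "topspace (carrier_top S) = (\<Union>(U, x)\<in>params S. x ` U)"
    using S by (simp add: lorentzian_surface_def oriented_surface_def)
  then obtain U x u where Ux: "(U, x) \<in> params S" and u: "u \<in> U" "q = x u" using q by auto
  let ?X = "immersion S \<circ> x"
  have U: "open U" and X: "smooth_on U ?X"
    and lor: "\<And>p. p \<in> U \<Longrightarrow> nondegenerate (first_form ?X p) \<and> form_index (first_form ?X p) = 1"
    using S Ux unfolding lorentzian_surface_def oriented_surface_def by blast+
  obtain W f1 f2 where WU: "u \<in> W" "W \<subseteq> U"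
    and f: "pseudo_orthonormal_frame ?X W f1 f2" "positively_oriented W f1 f2"
    using oriented_frame_exists[OF U X u(1) lor] by blast
  have loc: "local_frame S x W f1 f2"
    using Ux WU f by (auto simp: local_frame_def)
  interpret minimal_frame ?X W f1 f2
    by unfold_locales (use smooth_on_subset[OF X WU(2)] f min loc in \<open>auto simp: minimal_surface_def\<close>)
  have gauss': "\<nu> (x p) = minimal_frame.\<nu> ?X f1 f2 p" if "p \<in> W" for p
    using gauss loc that by (simp add: is_gauss_map_def local.\<nu>_def e1_def e2_def vf_deriv_def)
  have in_top: "x p \<in> topspace (carrier_top S)" if "p \<in> W" for p
  proof -
    have "x p \<in> x ` U" using WU that by auto
    then show ?thesis using UN_I[OF Ux, of "x p" "\<lambda>(U, x). x ` U"] by (simp add: top)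
  qed
  have smooth: "smooth_on W (g \<circ> x)" if "smooth_map S g" for g :: "'a \<Rightarrow> real^6"
    using that Ux WU(2) by (auto simp: smooth_map_def intro: smooth_on_subset)
  have "(A \<circ> x) u = 0 \<or> c + (B \<circ> x) u = 0"
  proof (rule eigenvector_dichotomy[OF _ _ _ _ _ \<mu> WU(1)])
    show "smooth_on W (A \<circ> x)" "smooth_on W (B \<circ> x)"
      using A B by (auto simp: laplace_eigenvector_def intro: smooth)
    show "minimal_frame.\<nu> ?X f1 f2 p = c + (A \<circ> x) p + (B \<circ> x) p" if "p \<in> W" for p
      using decomp[OF in_top[OF that]] gauss'[OF that] by simp
    show "laplacian ?X f1 f2 (A \<circ> x) p = \<mu> *\<^sub>R (A \<circ> x) p" if "p \<in> W" for p
      using A loc that by (auto simp: laplace_eigenvector_def)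
    show "laplacian ?X f1 f2 (B \<circ> x) p = 0" if "p \<in> W" for p
      using B loc that by (auto simp: laplace_eigenvector_def)
  qed
  moreover have "\<nu> q \<noteq> 0" using \<nu>_nonzero[OF WU(1)] gauss'[OF WU(1)] u by simp
  ultimately show ?thesis using u by simp
qed

text \<open>The eigenvector \<open>A\<close> belongs to the nonzero eigenvalue and \<open>B\<close> to the eigenvalue zero. By the
  pointwise alternative, the open sets where \<open>A \<noteq> 0\<close> and where \<open>B \<noteq> - c\<close> partition the surface.\<close>

theorem corollary4p4:
  shows "\<not> (\<exists>(S :: 'a surface) \<nu>. lorentzian_surface S \<and> minimal_surface S \<and>
            is_gauss_map S \<nu> \<and> null_k_type S 2 \<nu>)"
proof (rule notI, elim exE conjE)
  fix S :: "'a surface" and \<nu>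
  assume S: "lorentzian_surface S" and min: "minimal_surface S" and gauss: "is_gauss_map S \<nu>"
    and "null_k_type S 2 \<nu>"
  let ?T = "carrier_top S"
  from \<open>null_k_type S 2 \<nu>\<close> obtain c \<nu>s \<mu>s i where dec: "k_type_decomposition S 2 \<nu> c \<nu>s \<mu>s"
    and i: "i \<in> {1..2}" "\<mu>s i = 0" by (auto simp: null_k_type_def)
  define j where "j = 3 - i"
  have "i = 1 \<or> i = 2" using i(1) by auto
  then have j: "j \<in> {1..2}" "i \<noteq> j" "{1..2} = {i, j}" by (auto simp: j_def)
  have "strict_mono_on {1..2} \<mu>s" using dec by (simp add: k_type_decomposition_def)
  then have \<mu>: "\<mu>s j \<noteq> 0"
    using i j strict_mono_on_imp_inj_on[of "{1..2}" \<mu>s] by (metis inj_on_def)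
  define A B where "A = \<nu>s j" and "B = \<nu>s i"
  have A: "laplace_eigenvector S (\<mu>s j) A" "\<not> A constant_on topspace ?T"
    and B: "laplace_eigenvector S 0 B" "\<not> B constant_on topspace ?T"
    using dec i j unfolding k_type_decomposition_def A_def B_def by metis+
  have decomp: "\<nu> q = c + A q + B q" if "q \<in> topspace ?T" for q
    using dec that j by (simp add: k_type_decomposition_def A_def B_def)
  have point: "\<nu> q \<noteq> 0 \<and> (A q = 0 \<or> B q = - c)" if "q \<in> topspace ?T" for q
    using pointwise_dichotomy[OF S min gauss decomp A(1) B(1) \<mu> that]
    by (auto simp: eq_neg_iff_add_eq_0 add.commute)
  let ?P = "{q \<in> topspace ?T. A q \<noteq> 0}" and ?Q = "{q \<in> topspace ?T. B q \<noteq> - c}"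
  have "oriented_surface S" using S by (simp add: lorentzian_surface_def)
  then have "openin ?T ?P" "openin ?T ?Q"
    using A(1) B(1) by (auto simp: laplace_eigenvector_def intro!: openin_smooth_map_neq)
  moreover have "?P \<inter> ?Q = {}" using point by auto
  moreover have "topspace ?T \<subseteq> ?P \<union> ?Q"
  proof
    fix q assume q: "q \<in> topspace ?T"
    then have "\<not> (A q = 0 \<and> B q = - c)" using point[OF q] decomp[OF q] by auto
    then show "q \<in> ?P \<union> ?Q" using q by auto
  qed
  moreover have "connected_space ?T"
    using S by (simp add: lorentzian_surface_def oriented_surface_def)
  ultimately have "?P = {} \<or> ?Q = {}" unfolding connected_space_def by blast
  then have "A constant_on topspace ?T \<or> B constant_on topspace ?T"
    unfolding constant_on_def by blast
  then show False using A B by blast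
qed

end
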